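(* Let Assumptions 1, 2 and 3 hold, with $W_N\in\mathbb{R}^{N\times\bar N}$. Then every matrix $Z\in\mathbb{R}^{2n\times\bar N}$ satisfying \[\bar\Delta_NZ^\top+Z\bar\Delta_N^\top\prec 0,\qquad Z\bar\Phi_N^\top+\bar\Phi_NZ^\top\succ 0,\qquad Z\bar\Phi_N^\top-\bar\Phi_NZ^\top=0_{2n,2n}\] is such that $Z\bar\Phi_N^\top$ is invertible and the gain $K_{\mathrm f}=\bar\Upsilon_NZ^\top(Z\bar\Phi_N^\top)^{-1}$ makes $A_{\mathrm f}+B_{\mathrm f}K_{\mathrm f}$ Hurwitz. Conversely, if $K_{\mathrm f}\in\mathbb{R}^{1\times 2n}$ is such that $A_{\mathrm f}+B_{\mathrm f}K_{\mathrm f}$ is Hurwitz, then $K_{\mathrm f}=\bar\Upsilon_NZ^\top(Z\bar\Phi_N^\top)^{-1}$ for some $Z$ satisfying the three conditions above.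
   Context: Fix $n\ge 1$ and real numbers $a_1,\dots,a_n,b_1,\dots,b_n$. The plant is the continuous-time SISO system $y^{(n)}+a_1y^{(n-1)}+\dots+a_ny=b_1u^{(n-1)}+\dots+b_nu$, represented in observability canonical form $\dot x=Ax+Bu$, $y=Cx$, $x(t)\in\mathbb{R}^n$, $x(0)=x_0$, where $C=[0_{1,n-1}\;1]$, $A$ is the $n\times n$ matrix whose first $n-1$ columns are $\begin{bmatrix}0_{1,n-1}\\ I_{n-1}\end{bmatrix}$ and whose last column is $(-a_n,\dots,-a_1)^\top$, and $B=(b_n,\dots,b_1)^\top$; a locally integrable input $u$ is applied on $[0,t_N]$. Assumption 1: the polynomials $s^n+a_1s^{n-1}+\dots+a_n$ and $b_1s^{n-1}+\dots+b_n$ are coprime. For real parameters $c_1,\dots,c_n,\beta$, $A_{\mathrm r}\in\mathbb{R}^{n\times n}$ is the matrix whose first $n-1$ rows are $[0_{n-1,1}\;I_{n-1}]$ and whose last row is $(-c_n,\dots,-c_1)$, and $B_{\mathrm r}=(0,\dots,0,1)^\top\in\mathbb{R}^n$. Assumption 2: $-\beta$ is not an eigenvalue of $A_{\mathrm r}$. The filters are $\dot\zeta=A_{\mathrm r}\zeta+B_{\mathrm r}u$, $\zeta(0)=0$; $\dot\mu=A_{\mathrm r}\mu+B_{\mathrm r}y$, $\mu(0)=0$; $\chi=\mathrm{col}(\zeta,\mu)\in\mathbb{R}^{2n}$; $\dot\phi=-\beta\phi+\chi$, $\phi(0)=0_{2n,1}$; $\dot\upsilon=-\beta\upsilon+u$,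 $\upsilon(0)=0$; $\delta=\chi-\beta\phi$. Define $A_{\mathrm f}=\begin{bmatrix}A_{\mathrm r}&0_{n,n}\\ L_b& A_a\end{bmatrix}\in\mathbb{R}^{2n\times 2n}$, where $L_b\in\mathbb{R}^{n\times n}$ has all rows zero except the last, which equals $(b_n,\dots,b_1)$, and $A_a\in\mathbb{R}^{n\times n}$ has first $n-1$ rows $[0_{n-1,1}\;I_{n-1}]$ and last row $(-a_n,\dots,-a_1)$; $B_{\mathrm f}=\mathrm{col}(0_{n-1,1},1,0_{n,1})\in\mathbb{R}^{2n}$; $G_{\mathrm f}\in\mathbb{R}^{2n\times n}$ is the matrix whose only nonzero entry is a $1$ in position $(2n,n)$. Let $\Gamma^\star=G_{\mathrm f}(A_{\mathrm r}^\top+\beta I_n)^{-1}$ and $\epsilon(t)=\Gamma^\star(\mathrm{e}^{A_{\mathrm r}^\top t}-\mathrm{e}^{-\beta t}I_n)x_0$. For sampling times $0<t_1<\dots<t_N$ let $\Delta_N=[\delta(t_1)\cdots\delta(t_N)]$, $\Phi_N=[\phi(t_1)\cdots\phi(t_N)]\in\mathbb{R}^{2n\times N}$, $\Upsilon_N=[\upsilon(t_1)\cdots\upsilon(t_N)]\in\mathbb{R}^{1\times N}$, $E_N=[\epsilon(t_1)\cdots\epsilon(t_N)]$. Assumption 3: there is $W_N\in\mathbb{R}^{N\times\bar N}$ with $E_NW_N=0_{2n,\bar N}$ such that, with $\bar\Delta_N=\Delta_NW_N$, $\bar\Phi_N=\Phi_NW_N$, $\bar\Upsilon_N=\Upsilon_NW_N$,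 one has $\mathrm{rank}(\mathrm{col}(\bar\Phi_N,\bar\Upsilon_N))=2n+1$. $\prec 0$ / $\succ 0$ denote negative/positive definiteness of symmetric matrices; a matrix is Hurwitz if all its eigenvalues have negative real part. *)

theory Defs
  imports "HOL-Analysis.Analysis"
    "HOL-Computational_Algebra.Polynomial"
    "Jordan_Normal_Form.Gauss_Jordan_Elimination"
    "Jordan_Normal_Form.Char_Poly"
    "Jordan_Normal_Form.DL_Rank"
begin

(* Conventions: all vectors/matrices are Jordan_Normal_Form 'vec'/'mat' with 0-based indices.
   Coefficient sequences a, b, c are functions nat => real used at indices 1..n. *)

text \<open>Plant matrix A (observability canonical form): first n-1 columns are [0; I], last column
  is (-a_n, ..., -a_1)^T.\<close>
definition plant_A :: "nat \<Rightarrow> (nat \<Rightarrow> real) \<Rightarrow> real mat" where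
  "plant_A n a = mat n n (\<lambda>(i,j). if j < n - 1 then (if i = j + 1 then 1 else 0) else - a (n - i))"

definition plant_B :: "nat \<Rightarrow> (nat \<Rightarrow> real) \<Rightarrow> real vec" where
  "plant_B n b = vec n (\<lambda>i. b (n - i))"

definition comp_mat :: "nat \<Rightarrow> (nat \<Rightarrow> real) \<Rightarrow> real mat" where
  "comp_mat n c = mat n n (\<lambda>(i,j). if i < n - 1 then (if j = i + 1 then 1 else 0) else - c (n - j))"

definition filt_B :: "nat \<Rightarrow> real vec" where
  "filt_B n = unit_vec n (n - 1)"

definition L_b :: "nat \<Rightarrow> (nat \<Rightarrow> real) \<Rightarrow> real mat" where
  "L_b n b = mat n n (\<lambda>(i,j). if i = n - 1 then b (n - j) else 0)"

definition A_f :: "nat \<Rightarrow> (nat \<Rightarrow> real) \<Rightarrow> (nat \<Rightarrow> real) \<Rightarrow> (nat \<Rightarrow> real) \<Rightarrow> real mat" where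
  "A_f n a b c = four_block_mat (comp_mat n c) (0\<^sub>m n n) (L_b n b) (comp_mat n a)"

definition B_f :: "nat \<Rightarrow> real mat" where
  "B_f n = mat (2 * n) 1 (\<lambda>(i,j). if i = n - 1 then 1 else 0)"

definition G_f :: "nat \<Rightarrow> real mat" where
  "G_f n = mat (2 * n) n (\<lambda>(i,j). if i = 2 * n - 1 \<and> j = n - 1 then 1 else 0)"

definition mat_inv :: "real mat \<Rightarrow> real mat" where
  "mat_inv M = the (mat_inverse M)"

definition mat_exp :: "real mat \<Rightarrow> real mat" where
  "mat_exp M = mat (dim_row M) (dim_col M) (\<lambda>(i,j). \<Sum>k. (M ^\<^sub>m k) $$ (i,j) / fact k)"

definition Gamma_star :: "nat \<Rightarrow> (nat \<Rightarrow> real) \<Rightarrow> real \<Rightarrow> real mat" where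
  "Gamma_star n c \<beta> = G_f n * mat_inv (transpose_mat (comp_mat n c) + \<beta> \<cdot>\<^sub>m 1\<^sub>m n)"

definition eps_fun :: "nat \<Rightarrow> (nat \<Rightarrow> real) \<Rightarrow> real \<Rightarrow> real vec \<Rightarrow> real \<Rightarrow> real vec" where
  "eps_fun n c \<beta> x0 t = Gamma_star n c \<beta> *\<^sub>v
     ((mat_exp (t \<cdot>\<^sub>m transpose_mat (comp_mat n c)) - exp (- \<beta> * t) \<cdot>\<^sub>m 1\<^sub>m n) *\<^sub>v x0)"

definition den_poly :: "nat \<Rightarrow> (nat \<Rightarrow> real) \<Rightarrow> real poly" where
  "den_poly n a = monom 1 n + (\<Sum>k = 1..n. monom (a k) (n - k))"

definition num_poly :: "nat \<Rightarrow> (nat \<Rightarrow> real) \<Rightarrow> real poly" where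
  "num_poly n b = (\<Sum>k = 1..n. monom (b k) (n - k))"

text \<open>Solution (in the Caratheodory sense, i.e. via the integral equation) of
  x' = M x + g(t), x(0) = x0 on [0,T].\<close>
definition lin_ode_sol :: "real mat \<Rightarrow> (real \<Rightarrow> real vec) \<Rightarrow> real vec \<Rightarrow> real \<Rightarrow> (real \<Rightarrow> real vec) \<Rightarrow> bool" where
  "lin_ode_sol M g x0 T x \<longleftrightarrow> x0 \<in> carrier_vec (dim_row M) \<and>
     (\<forall>t\<in>{0..T}. x t \<in> carrier_vec (dim_row M) \<and>
        (\<forall>i < dim_row M. ((\<lambda>s. (M *\<^sub>v x s) $ i + g s $ i) has_integral (x t $ i - x0 $ i)) {0..t}))"

definition sample_mat :: "nat \<Rightarrow> nat \<Rightarrow> (nat \<Rightarrow> real) \<Rightarrow> (real \<Rightarrow> real vec) \<Rightarrow> real mat" where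
  "sample_mat m N t f = mat m N (\<lambda>(i,k). f (t (k + 1)) $ i)"

definition pos_def :: "real mat \<Rightarrow> bool" where
  "pos_def M \<longleftrightarrow> square_mat M \<and> transpose_mat M = M \<and>
     (\<forall>v \<in> carrier_vec (dim_row M). v \<noteq> 0\<^sub>v (dim_row M) \<longrightarrow> v \<bullet> (M *\<^sub>v v) > 0)"

definition neg_def :: "real mat \<Rightarrow> bool" where
  "neg_def M \<longleftrightarrow> square_mat M \<and> transpose_mat M = M \<and>
     (\<forall>v \<in> carrier_vec (dim_row M). v \<noteq> 0\<^sub>v (dim_row M) \<longrightarrow> v \<bullet> (M *\<^sub>v v) < 0)"

definition hurwitz :: "real mat \<Rightarrow> bool" where
  "hurwitz M \<longleftrightarrow> square_mat M \<and>
     (\<forall>z. eigenvalue (map_mat complex_of_real M) z \<longrightarrow> Re z < 0)"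

end

theory Submission
  imports Defs "Jordan_Normal_Form.Schur_Decomposition"
begin

text \<open>
  The state of the plant equals a constant linear image of the filter state \<open>\<chi>\<close> plus the free
  response of an observer with matrix \<open>A\<^sub>r\<close> transposed. Hence \<open>\<chi>\<close> obeys a linear equation with
  matrix \<open>A\<^sub>f\<close>, and filtering once more by \<open>1 / (s + \<beta>)\<close> gives the derivative-free relation
  \<open>\<delta> = A\<^sub>f \<phi> + B\<^sub>f \<upsilon> + \<epsilon>\<close>. Multiplication of the samples by \<open>W\<close> removes \<open>\<epsilon>\<close>, so that
  \<open>D = A\<^sub>f P + B\<^sub>f U\<close> for the transformed data. With \<open>S = Z P\<^sup>T\<close> and \<open>K = U Z\<^sup>T S\<^sup>-\<^sup>1\<close> the three
  conditions on \<open>Z\<close> say that \<open>S\<close> is symmetric positive definite and solves the Lyapunov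
  inequality of \<open>A\<^sub>f + B\<^sub>f K\<close>; conversely, full row rank of the data allows one to realize any such
  pair \<open>(S, K S)\<close> by some \<open>Z\<close>.
\<close>

subsection \<open>Lyapunov inequalities\<close>

text \<open>The input is only integrable, so the signals it drives need not be differentiable
  everywhere. The dynamics are therefore kept as integral equations, and the formulas for the output
  and for \<delta> are proved by showing that both sides satisfy the same linear integral equation
  from the same start; a Gronwall estimate gives equality. The constant linear image of \<chi> is
  built from symmetric matrices \<open>S\<close> with \<open>S * C = transpose_mat C * S\<close>,
  where \<open>C\<close> is the companion matrix of the filters: they carry a filter into an
  observer for the plant, while \<open>S *\<^sub>v filt_B n\<close> can be prescribed freely. The
  Lyapunov inequality occurs in the dual form \<open>A * S + S * transpose_mat A\<close> because the
  products \<open>S\<close> and \<open>K * S\<close>, unlike \<open>K\<close> itself, are linear in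
  \<open>Z\<close>. Its converse half rescales a triangular form of the matrix by diagonal weights
  instead of integrating matrix exponentials, so that it stays finite-dimensional algebra.\<close>

lemma mat_inv_inverse:
  assumes M: "M \<in> carrier_mat n n" and d: "det M \<noteq> 0"
  shows "M * mat_inv M = 1\<^sub>m n" "mat_inv M * M = 1\<^sub>m n" "mat_inv M \<in> carrier_mat n n"
proof -
  have "M \<in> Units (ring_mat TYPE(real) n ())"
    using det_non_zero_imp_unit[OF M d] .
  then obtain B where "mat_inverse M = Some B"
    using mat_inverse(1)[OF M, where b = "()"] by (cases "mat_inverse M") auto
  then show "M * mat_inv M = 1\<^sub>m n" "mat_inv M * M = 1\<^sub>m n" "mat_inv M \<in> carrier_mat n n"
    using mat_inverse(2)[OF M] unfolding mat_inv_def by auto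
qed

lemma pos_def_det_nonzero:
  assumes S: "S \<in> carrier_mat n n" and p: "pos_def S"
  shows "det S \<noteq> 0"
proof
  assume "det S = 0"
  then obtain v where v: "v \<in> carrier_vec n" "v \<noteq> 0\<^sub>v n" "S *\<^sub>v v = 0\<^sub>v n"
    using det_0_iff_vec_prod_zero[OF S] by auto
  have "v \<bullet> (S *\<^sub>v v) > 0" using p S v unfolding pos_def_def by auto
  then show False using v by simp
qed

text \<open>Symmetry of \<open>S\<close> makes the two summands contribute equally. This shape
  isolates the action of the transposed matrix, into which either an eigenvector or a triangular
  form can be inserted.\<close>

lemma lyapunov_form:
  fixes A S :: "real mat"
  assumes A: "A \<in> carrier_mat n n" and S: "S \<in> carrier_mat n n" and sym: "transpose_mat S = S"
    and v: "v \<in> carrier_vec n"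
  shows "v \<bullet> ((A * S + S * transpose_mat A) *\<^sub>v v) = 2 * ((transpose_mat A *\<^sub>v v) \<bullet> (S *\<^sub>v v))"
proof -
  have At: "transpose_mat A \<in> carrier_mat n n" using A by auto
  have 1: "v \<bullet> (A *\<^sub>v (S *\<^sub>v v)) = (transpose_mat A *\<^sub>v v) \<bullet> (S *\<^sub>v v)"
    using transpose_vec_mult_scalar[OF A, of "S *\<^sub>v v" v] S v by auto
  have 2: "v \<bullet> (S *\<^sub>v (transpose_mat A *\<^sub>v v)) = (S *\<^sub>v v) \<bullet> (transpose_mat A *\<^sub>v v)"
    using transpose_vec_mult_scalar[OF S, of "transpose_mat A *\<^sub>v v" v] S At v sym by auto
  have "(S *\<^sub>v v) \<bullet> (transpose_mat A *\<^sub>v v) = (transpose_mat A *\<^sub>v v) \<bullet> (S *\<^sub>v v)"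
    by (rule comm_scalar_prod[of _ n]) (use S At v in auto)
  moreover have "(A * S + S * transpose_mat A) *\<^sub>v v = A *\<^sub>v (S *\<^sub>v v) + S *\<^sub>v (transpose_mat A *\<^sub>v v)"
    using A S At v by (simp add: add_mult_distrib_mat_vec[of _ n n])
  moreover have "v \<bullet> (A *\<^sub>v (S *\<^sub>v v) + S *\<^sub>v (transpose_mat A *\<^sub>v v)) =
      v \<bullet> (A *\<^sub>v (S *\<^sub>v v)) + v \<bullet> (S *\<^sub>v (transpose_mat A *\<^sub>v v))"
    by (rule scalar_prod_add_distrib[of _ n]) (use A S At v in auto)
  ultimately show ?thesis using 1 2 by simp
qed

lemma transpose_lyapunov:
  fixes A S :: "real mat"
  assumes A: "A \<in> carrier_mat n n" and S: "S \<in> carrier_mat n n" and sym: "transpose_mat S = S"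
  shows "transpose_mat (A * S + S * transpose_mat A) = A * S + S * transpose_mat A"
proof -
  have "transpose_mat (A * S + S * transpose_mat A) = transpose_mat (A * S) + transpose_mat (S * transpose_mat A)"
    by (rule transpose_add[of _ n n]) (use A S in auto)
  also have "\<dots> = S * transpose_mat A + A * S"
    using A S sym by (simp add: transpose_mult[of _ n n _ n])
  also have "\<dots> = A * S + S * transpose_mat A"
    by (rule comm_add_mat[of _ n n]) (use A S in auto)
  finally show ?thesis .
qed

lemma eigenvalue_transpose:
  fixes A :: "'a :: field mat"
  assumes "A \<in> carrier_mat n n"
  shows "eigenvalue (transpose_mat A) z \<longleftrightarrow> eigenvalue A z"
  using assms eigenvalue_root_char_poly[of A n] eigenvalue_root_char_poly[of "transpose_mat A" n] by simp

text \<open>For an eigenvector w of the transposed matrix, the Hermitian form of the Lyapunov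
  expression at w is 2 Re z times that of \<open>S\<close>. Definiteness is known on real vectors
  only, so w is split into real and imaginary parts and the two real forms are added; the terms with
  Im z cancel because \<open>S\<close> is symmetric.\<close>

lemma lyapunov_imp_hurwitz:
  fixes A S :: "real mat"
  assumes A: "A \<in> carrier_mat n n" and S: "S \<in> carrier_mat n n" and p: "pos_def S"
    and neg: "neg_def (A * S + S * transpose_mat A)"
  shows "hurwitz A"
  unfolding hurwitz_def
proof (intro conjI allI impI)
  show "square_mat A" using A by auto
  fix z assume "eigenvalue (map_mat complex_of_real A) z"
  then have "eigenvalue (transpose_mat (map_mat complex_of_real A)) z"
    using eigenvalue_transpose[of "map_mat complex_of_real A" n] A by auto
  then obtain w where w: "w \<in> carrier_vec n" "w \<noteq> 0\<^sub>v n"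
      and Aw: "transpose_mat (map_mat complex_of_real A) *\<^sub>v w = z \<cdot>\<^sub>v w"
    using A unfolding eigenvalue_def eigenvector_def by auto
  have sym: "transpose_mat S = S" using p unfolding pos_def_def by auto
  define p q where "p = map_vec Re w" and "q = map_vec Im w"
  have pc: "p \<in> carrier_vec n" and qc: "q \<in> carrier_vec n" using w by (auto simp: p_def q_def)
  have At: "transpose_mat A \<in> carrier_mat n n" using A by auto
  have comp: "(\<Sum>j<n. complex_of_real (A $$ (j,i)) * w $ j) = z * w $ i" if "i < n" for i
  proof -
    have "(transpose_mat (map_mat complex_of_real A) *\<^sub>v w) $ i = z * w $ i"
      using Aw w that by simp
    then show ?thesis using A w that by (simp add: scalar_prod_def lessThan_atLeast0)
  qed
  have Ap: "transpose_mat A *\<^sub>v p = Re z \<cdot>\<^sub>v p - Im z \<cdot>\<^sub>v q"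
  proof (rule eq_vecI)
    fix i assume "i < dim_vec (Re z \<cdot>\<^sub>v p - Im z \<cdot>\<^sub>v q)"
    then have i: "i < n" using qc by auto
    from arg_cong[OF comp[OF i], of Re]
    show "(transpose_mat A *\<^sub>v p) $ i = (Re z \<cdot>\<^sub>v p - Im z \<cdot>\<^sub>v q) $ i"
      using i A w by (simp add: scalar_prod_def lessThan_atLeast0 p_def q_def)
  qed (use A qc in auto)
  have Aq: "transpose_mat A *\<^sub>v q = Im z \<cdot>\<^sub>v p + Re z \<cdot>\<^sub>v q"
  proof (rule eq_vecI)
    fix i assume "i < dim_vec (Im z \<cdot>\<^sub>v p + Re z \<cdot>\<^sub>v q)"
    then have i: "i < n" using qc by auto
    from arg_cong[OF comp[OF i], of Im]
    show "(transpose_mat A *\<^sub>v q) $ i = (Im z \<cdot>\<^sub>v p + Re z \<cdot>\<^sub>v q) $ i"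
      using i A w by (simp add: scalar_prod_def lessThan_atLeast0 p_def q_def)
  qed (use A qc in auto)
  have Sp: "S *\<^sub>v p \<in> carrier_vec n" and Sq: "S *\<^sub>v q \<in> carrier_vec n" using S pc qc by auto
  have comm: "p \<bullet> (S *\<^sub>v q) = q \<bullet> (S *\<^sub>v p)"
    using transpose_vec_mult_scalar[OF S qc pc] comm_scalar_prod[OF Sp qc] sym by simp
  have fp: "(transpose_mat A *\<^sub>v p) \<bullet> (S *\<^sub>v p) = Re z * (p \<bullet> (S *\<^sub>v p)) - Im z * (q \<bullet> (S *\<^sub>v p))"
    unfolding Ap using pc qc Sp by (subst minus_scalar_prod_distrib[of _ n]) auto
  have fq: "(transpose_mat A *\<^sub>v q) \<bullet> (S *\<^sub>v q) = Im z * (p \<bullet> (S *\<^sub>v q)) + Re z * (q \<bullet> (S *\<^sub>v q))"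
    unfolding Aq using pc qc Sq by (subst add_scalar_prod_distrib[of _ n]) auto
  let ?L = "A * S + S * transpose_mat A"
  have Lc: "?L \<in> carrier_mat n n" using A S At by auto
  have sum: "p \<bullet> (?L *\<^sub>v p) + q \<bullet> (?L *\<^sub>v q) = 2 * Re z * (p \<bullet> (S *\<^sub>v p) + q \<bullet> (S *\<^sub>v q))"
    unfolding lyapunov_form[OF A S sym pc] lyapunov_form[OF A S sym qc] fp fq comm
    by (simp add: algebra_simps)
  have ne: "p \<noteq> 0\<^sub>v n \<or> q \<noteq> 0\<^sub>v n"
  proof (rule ccontr)
    assume "\<not> (p \<noteq> 0\<^sub>v n \<or> q \<noteq> 0\<^sub>v n)"
    then have "\<forall>i<n. Re (w $ i) = 0 \<and> Im (w $ i) = 0"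
      using w unfolding p_def q_def by (metis carrier_vecD index_map_vec(1) index_zero_vec(1))
    then have "w = 0\<^sub>v n" using w by (intro eq_vecI) (auto simp: complex_eq_iff)
    then show False using w by simp
  qed
  have L_neg: "v \<bullet> (?L *\<^sub>v v) < 0" if "v \<in> carrier_vec n" "v \<noteq> 0\<^sub>v n" for v
    using neg Lc that unfolding neg_def_def by auto
  have S_pos: "v \<bullet> (S *\<^sub>v v) > 0" if "v \<in> carrier_vec n" "v \<noteq> 0\<^sub>v n" for v
    using assms(3) S that unfolding pos_def_def by auto
  have z0: "0\<^sub>v n \<bullet> (?L *\<^sub>v 0\<^sub>v n) = 0" "0\<^sub>v n \<bullet> (S *\<^sub>v 0\<^sub>v n) = 0"
    using Lc S by auto
  \<comment> \<open>One of the two parts may vanish, for instance when z is real; the other one then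
    supplies the strict sign.\<close>
  have "p \<bullet> (?L *\<^sub>v p) + q \<bullet> (?L *\<^sub>v q) < 0"
    using L_neg[OF pc] L_neg[OF qc] z0 ne
    by (cases "p = 0\<^sub>v n"; cases "q = 0\<^sub>v n") auto
  moreover have "p \<bullet> (S *\<^sub>v p) + q \<bullet> (S *\<^sub>v q) > 0"
    using S_pos[OF pc] S_pos[OF qc] z0 ne
    by (cases "p = 0\<^sub>v n"; cases "q = 0\<^sub>v n") auto
  ultimately show "Re z < 0" unfolding sum by (simp add: mult_less_0_iff)
qed

text \<open>Each new weight is chosen so large that, by AM-GM, its diagonal term absorbs the cross terms
  of the new column.\<close>

lemma triangular_weights:
  fixes T :: "nat \<Rightarrow> nat \<Rightarrow> complex"
  assumes "\<And>i. i < n \<Longrightarrow> Re (T i i) < 0"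
  shows "\<exists>d \<eta>. (\<forall>i<n. d i > 0) \<and> \<eta> > 0 \<and>
    (\<forall>z. Re (\<Sum>i<n. of_real (d i) * cnj (z i) * (\<Sum>j\<in>{i..<n}. T i j * z j))
       \<le> - \<eta> * (\<Sum>i<n. (cmod (z i))\<^sup>2))"
  using assms
proof (induction n)
  case 0
  show ?case by (intro exI[of _ "\<lambda>_. 1"] exI[of _ 1]) auto
next
  case (Suc n)
  then obtain d \<eta> where d: "\<And>i. i < n \<Longrightarrow> d i > (0::real)" and \<eta>: "\<eta> > (0::real)"
    and IH: "\<And>z. Re (\<Sum>i<n. of_real (d i) * cnj (z i) * (\<Sum>j\<in>{i..<n}. T i j * z j))
       \<le> - \<eta> * (\<Sum>i<n. (cmod (z i))\<^sup>2)"
    by (auto simp: less_Suc_eq)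
  define C where "C = (\<Sum>i<n. (d i * cmod (T i n))\<^sup>2)"
  have Tn: "Re (T n n) < 0" using Suc.prems by auto
  \<comment> \<open>Half of the old margin \<eta> pays for the old coordinates in the AM-GM bound.
    The share of that bound on the new coordinate is C / (2 \<eta>); \<open>dn\<close> is fixed so
    that the diagonal term covers it and leaves \<eta> / 2, the new margin, in every
    coordinate.\<close>
  define dn where "dn = (\<eta> / 2 + C / (2 * \<eta>)) / (- Re (T n n))"
  have Cpos: "C \<ge> 0" unfolding C_def by (intro sum_nonneg) auto
  then have "\<eta> / 2 + C / (2 * \<eta>) > 0" using \<eta> by (simp add: add_pos_nonneg)
  then have dn: "dn > 0" unfolding dn_def using Tn by (intro divide_pos_pos) auto
  have dnT: "dn * Re (T n n) = - (\<eta> / 2 + C / (2 * \<eta>))" unfolding dn_def using Tn by (simp add: field_simps)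
  let ?d = "d(n := dn)"
  have key: "Re (\<Sum>i<Suc n. of_real (?d i) * cnj (z i) * (\<Sum>j\<in>{i..<Suc n}. T i j * z j))
       \<le> - (\<eta> / 2) * (\<Sum>i<Suc n. (cmod (z i))\<^sup>2)" for z
  proof -
    have 1: "(\<Sum>i<n. of_real (?d i) * cnj (z i) * (\<Sum>j\<in>{i..<Suc n}. T i j * z j))
       = (\<Sum>i<n. of_real (d i) * cnj (z i) * (\<Sum>j\<in>{i..<n}. T i j * z j))
        + (\<Sum>i<n. of_real (d i) * cnj (z i) * (T i n * z n))"
      unfolding sum.distrib[symmetric] by (intro sum.cong) (auto simp: algebra_simps)
    have 2: "Re (of_real dn * cnj (z n) * (T n n * z n)) = dn * Re (T n n) * (cmod (z n))\<^sup>2"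
      unfolding cmod_power2 by (simp add: algebra_simps power2_eq_square)
    have 3: "Re (of_real (d i) * cnj (z i) * (T i n * z n)) \<le>
        \<eta> / 2 * (cmod (z i))\<^sup>2 + (d i * cmod (T i n))\<^sup>2 * (cmod (z n))\<^sup>2 / (2 * \<eta>)" if "i < n" for i
    proof -
      have "Re (of_real (d i) * cnj (z i) * (T i n * z n)) \<le> cmod (of_real (d i) * cnj (z i) * (T i n * z n))"
        by (rule complex_Re_le_cmod)
      also have "\<dots> = cmod (z i) * (d i * cmod (T i n) * cmod (z n))"
        using d[OF that] by (simp add: norm_mult)
      also have "\<dots> \<le> \<eta> / 2 * (cmod (z i))\<^sup>2 + (d i * cmod (T i n) * cmod (z n))\<^sup>2 / (2 * \<eta>)"
      proof -
        define x y where "x = cmod (z i)" and "y = d i * cmod (T i n) * cmod (z n)"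
        have "0 \<le> (\<eta> * x - y)\<^sup>2 / (2 * \<eta>)" using \<eta> by simp
        also have "\<dots> = \<eta> / 2 * x\<^sup>2 + y\<^sup>2 / (2 * \<eta>) - x * y"
          using \<eta> by (simp add: power2_eq_square field_simps)
        finally show ?thesis unfolding x_def y_def by simp
      qed
      finally show ?thesis by (simp add: power_mult_distrib)
    qed
    have "Re (\<Sum>i<n. of_real (d i) * cnj (z i) * (T i n * z n)) \<le>
      (\<Sum>i<n. \<eta> / 2 * (cmod (z i))\<^sup>2 + (d i * cmod (T i n))\<^sup>2 * (cmod (z n))\<^sup>2 / (2 * \<eta>))"
      unfolding Re_sum by (intro sum_mono 3) auto
    also have "\<dots> = \<eta> / 2 * (\<Sum>i<n. (cmod (z i))\<^sup>2) + C / (2 * \<eta>) * (cmod (z n))\<^sup>2"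
      unfolding C_def sum.distrib sum_distrib_left sum_distrib_right sum_divide_distrib by simp
    finally have 4: "Re (\<Sum>i<n. of_real (d i) * cnj (z i) * (T i n * z n)) \<le>
        \<eta> / 2 * (\<Sum>i<n. (cmod (z i))\<^sup>2) + C / (2 * \<eta>) * (cmod (z n))\<^sup>2" .
    have "Re (\<Sum>i<Suc n. of_real (?d i) * cnj (z i) * (\<Sum>j\<in>{i..<Suc n}. T i j * z j))
      = Re (\<Sum>i<n. of_real (d i) * cnj (z i) * (\<Sum>j\<in>{i..<n}. T i j * z j))
        + Re (\<Sum>i<n. of_real (d i) * cnj (z i) * (T i n * z n))
        + dn * Re (T n n) * (cmod (z n))\<^sup>2"
      unfolding sum.lessThan_Suc 1 2[symmetric] by simp
    also have "\<dots> \<le> - \<eta> * (\<Sum>i<n. (cmod (z i))\<^sup>2)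
        + (\<eta> / 2 * (\<Sum>i<n. (cmod (z i))\<^sup>2) + C / (2 * \<eta>) * (cmod (z n))\<^sup>2)
        - (\<eta> / 2 + C / (2 * \<eta>)) * (cmod (z n))\<^sup>2"
      unfolding dnT using IH[of z] 4 by linarith
    also have "\<dots> = - (\<eta> / 2) * (\<Sum>i<Suc n. (cmod (z i))\<^sup>2)"
      by (simp add: algebra_simps)
    finally show ?thesis .
  qed
  show ?case
    by (rule exI[of _ ?d], rule exI[of _ "\<eta> / 2"]) (use d dn \<eta> key in \<open>auto simp: less_Suc_eq simp del: sum.lessThan_Suc fun_upd_apply\<close>, auto)
qed

text \<open>In triangular coordinates a diagonal form with suitable weights already decreases
  strictly, so it only has to be pulled back to the original coordinates. The triangularization is
  applied to the transposed matrix, and only the similarity is used, not unitarity of the change of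
  basis.\<close>

lemma hurwitz_imp_lyapunov:
  fixes A :: "real mat"
  assumes A: "A \<in> carrier_mat n n" and h: "hurwitz A"
  shows "\<exists>S \<in> carrier_mat n n. pos_def S \<and> neg_def (A * S + S * transpose_mat A)"
proof -
  define M where "M = map_mat complex_of_real (transpose_mat A)"
  have M: "M \<in> carrier_mat n n" using A by (auto simp: M_def)
  have Meq: "M = transpose_mat (map_mat complex_of_real A)" unfolding M_def by auto
  obtain es where es: "char_poly M = (\<Prod>e\<leftarrow>es. [:- e, 1:])"
    using char_poly_factorized[OF M] by auto
  obtain T P Q where "schur_decomposition M es = (T, P, Q)" by (metis prod_cases3)
  from schur_decomposition[OF M es this]
  have wit: "similar_mat_wit M T P Q" and ut: "upper_triangular T" and diag: "diag_mat T = es" by auto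
  from similar_mat_witD2[OF M wit]
  have PQ: "P * Q = 1\<^sub>m n" "Q * P = 1\<^sub>m n" and MT: "M = P * T * Q"
    and c: "T \<in> carrier_mat n n" "P \<in> carrier_mat n n" "Q \<in> carrier_mat n n" by auto
  have neg: "Re (T $$ (i,i)) < 0" if "i < n" for i
  proof -
    have "T $$ (i,i) \<in> set es" unfolding diag[symmetric] diag_mat_def using that c by auto
    then have "poly (char_poly M) (T $$ (i,i)) = 0" unfolding es by (rule linear_poly_root)
    then have "eigenvalue M (T $$ (i,i))" using eigenvalue_root_char_poly[OF M] by simp
    then have "eigenvalue (map_mat complex_of_real A) (T $$ (i,i))"
      unfolding Meq using eigenvalue_transpose[of "map_mat complex_of_real A" n] A by auto
    then show ?thesis using h unfolding hurwitz_def by blast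
  qed
  obtain d \<eta> where d: "\<And>i. i < n \<Longrightarrow> d i > (0::real)" and \<eta>: "\<eta> > (0::real)"
    and W: "\<And>z. Re (\<Sum>i<n. of_real (d i) * cnj (z i) * (\<Sum>j\<in>{i..<n}. T $$ (i,j) * z j))
       \<le> - \<eta> * (\<Sum>i<n. (cmod (z i))\<^sup>2)"
    using triangular_weights[of n "\<lambda>i j. T $$ (i,j)"] neg by blast
  \<comment> \<open>This is the weighted form pulled back along \<open>Q\<close>. The pulled-back
    matrix is Hermitian but may be complex; its real part is symmetric and has the same quadratic
    form on real vectors.\<close>
  define S where "S = mat n n (\<lambda>(j,k). Re (\<Sum>i<n. of_real (d i) * cnj (Q $$ (i,j)) * Q $$ (i,k)))"
  have S: "S \<in> carrier_mat n n" unfolding S_def by auto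
  have sym: "transpose_mat S = S"
    by (rule eq_matI) (auto simp: S_def algebra_simps)
  define q where "q v i = (\<Sum>j<n. Q $$ (i,j) * complex_of_real (v $ j))" for v i
  have form: "v \<bullet> (S *\<^sub>v w) = Re (\<Sum>i<n. of_real (d i) * cnj (q v i) * q w i)"
    if v: "v \<in> carrier_vec n" and w: "w \<in> carrier_vec n" for v w
  proof -
    have "v \<bullet> (S *\<^sub>v w) = (\<Sum>j<n. \<Sum>k<n. v $ j * (S $$ (j,k) * w $ k))"
      using v w S by (simp add: scalar_prod_def lessThan_atLeast0 sum_distrib_left)
    also have "\<dots> = (\<Sum>j<n. \<Sum>k<n. \<Sum>i<n. Re (of_real (d i) * (cnj (Q $$ (i,j)) * of_real (v $ j)) * (Q $$ (i,k) * of_real (w $ k))))"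
      by (intro sum.cong refl)
        (auto simp: S_def sum_distrib_left sum_distrib_right algebra_simps intro!: sum.cong)
    also have "\<dots> = (\<Sum>j<n. \<Sum>i<n. \<Sum>k<n. Re (of_real (d i) * (cnj (Q $$ (i,j)) * of_real (v $ j)) * (Q $$ (i,k) * of_real (w $ k))))"
      by (intro sum.cong refl sum.swap)
    also have "\<dots> = (\<Sum>i<n. \<Sum>j<n. \<Sum>k<n. Re (of_real (d i) * (cnj (Q $$ (i,j)) * of_real (v $ j)) * (Q $$ (i,k) * of_real (w $ k))))"
      by (rule sum.swap)
    also have "\<dots> = Re (\<Sum>i<n. of_real (d i) * cnj (q v i) * q w i)"
    proof -
      have "of_real (d i) * cnj (q v i) * q w i = (\<Sum>j<n. \<Sum>k<n.
          of_real (d i) * (cnj (Q $$ (i,j)) * of_real (v $ j)) * (Q $$ (i,k) * of_real (w $ k)))" for i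
      proof -
        have "of_real (d i) * cnj (q v i) * q w i =
            of_real (d i) * ((\<Sum>j<n. cnj (Q $$ (i,j)) * of_real (v $ j)) * (\<Sum>k<n. Q $$ (i,k) * of_real (w $ k)))"
          by (simp add: q_def mult.assoc)
        then show ?thesis unfolding sum_product unfolding sum_distrib_left by (simp add: mult.assoc)
      qed
      then show ?thesis by simp
    qed
    finally show ?thesis .
  qed
  have q_vec: "q v i = (Q *\<^sub>v map_vec complex_of_real v) $ i" if "v \<in> carrier_vec n" "i < n" for v i
    using that c by (simp add: q_def scalar_prod_def lessThan_atLeast0)
  have q_ne: "(\<Sum>i<n. (cmod (q v i))\<^sup>2) > 0" if v: "v \<in> carrier_vec n" "v \<noteq> 0\<^sub>v n" for v
  proof -
    have "\<exists>i<n. q v i \<noteq> 0"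
    proof (rule ccontr)
      assume "\<not> ?thesis"
      then have "Q *\<^sub>v map_vec complex_of_real v = 0\<^sub>v n"
        using v c q_vec[OF v(1)] by (intro eq_vecI) auto
      then have "P *\<^sub>v (Q *\<^sub>v map_vec complex_of_real v) = 0\<^sub>v n"
        using c by (intro eq_vecI) auto
      moreover have "P *\<^sub>v (Q *\<^sub>v map_vec complex_of_real v) = map_vec complex_of_real v"
        using c v PQ by (subst assoc_mult_mat_vec[symmetric, of _ n n _ n]) auto
      ultimately have "map_vec complex_of_real v = 0\<^sub>v n" by simp
      then have "\<forall>i<n. complex_of_real (v $ i) = 0"
        using v by (metis carrier_vecD index_map_vec(1) index_zero_vec(1))
      then have "v = 0\<^sub>v n" using v by (intro eq_vecI) auto
      then show False using v by simp
    qed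
    then obtain i where "i < n" "q v i \<noteq> 0" by auto
    then show ?thesis by (intro sum_pos2[of _ i]) auto
  qed
  have Spos: "pos_def S" unfolding pos_def_def
  proof (intro conjI ballI impI)
    show "square_mat S" "transpose_mat S = S" using S sym by auto
    fix v :: "real vec" assume "v \<in> carrier_vec (dim_row S)" and "v \<noteq> 0\<^sub>v (dim_row S)"
    then have v: "v \<in> carrier_vec n" "v \<noteq> 0\<^sub>v n" using S by auto
    have "v \<bullet> (S *\<^sub>v v) = (\<Sum>i<n. d i * (cmod (q v i))\<^sup>2)"
      unfolding form[OF v(1) v(1)] Re_sum cmod_power2
      by (intro sum.cong refl) (simp add: algebra_simps power2_eq_square)
    also have "\<dots> > 0"
    proof -
      obtain i where "i < n" "(cmod (q v i))\<^sup>2 > 0"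
        using q_ne[OF v] by (metis lessThan_iff linorder_not_le sum_nonpos)
      then show ?thesis using d by (intro sum_pos2[of _ i]) (auto simp: less_imp_le)
    qed
    finally show "v \<bullet> (S *\<^sub>v v) > 0" .
  qed
  let ?L = "A * S + S * transpose_mat A"
  have L: "?L \<in> carrier_mat n n" using A S by auto
  have "neg_def ?L" unfolding neg_def_def
  proof (intro conjI ballI impI)
    show "square_mat ?L" using A S by auto
    show "transpose_mat ?L = ?L" by (rule transpose_lyapunov[OF A S sym])
    fix v :: "real vec" assume "v \<in> carrier_vec (dim_row ?L)" and "v \<noteq> 0\<^sub>v (dim_row ?L)"
    then have v: "v \<in> carrier_vec n" "v \<noteq> 0\<^sub>v n" using A S by auto
    let ?cv = "map_vec complex_of_real v"
    let ?w = "transpose_mat A *\<^sub>v v"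
    have w: "?w \<in> carrier_vec n" using A v by auto
    have cw: "map_vec complex_of_real ?w = M *\<^sub>v ?cv"
      by (rule eq_vecI) (use A v in \<open>auto simp: M_def scalar_prod_def\<close>)
    have cv: "?cv \<in> carrier_vec n" using v by auto
    have QM: "Q *\<^sub>v (M *\<^sub>v ?cv) = T *\<^sub>v (Q *\<^sub>v ?cv)"
    proof -
      have "Q * M = Q * P * (T * Q)" unfolding MT using c by (simp add: assoc_mult_mat[of _ n n _ n _ n])
      then have "Q * M = T * Q" using PQ c by simp
      then show ?thesis using c M cv by (metis assoc_mult_mat_vec)
    qed
    \<comment> \<open>In the coordinates \<open>q\<close> the transposed matrix acts as
      \<open>T\<close>, and the zeros below the diagonal cut the sum to the range that the weight
      inequality \<open>W\<close> expects.\<close>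
    have qw: "q ?w i = (\<Sum>j\<in>{i..<n}. T $$ (i,j) * q v j)" if i: "i < n" for i
    proof -
      have "q ?w i = (T *\<^sub>v (Q *\<^sub>v ?cv)) $ i" using q_vec[OF w i] cw QM by simp
      also have "\<dots> = (\<Sum>j<n. T $$ (i,j) * q v j)"
        using c i q_vec[OF v(1)] by (simp add: scalar_prod_def lessThan_atLeast0)
      also have "\<dots> = (\<Sum>j\<in>{i..<n}. T $$ (i,j) * q v j)"
        by (rule sum.mono_neutral_right) (use ut i c in \<open>auto simp: upper_triangular_def\<close>)
      finally show ?thesis .
    qed
    have "?w \<bullet> (S *\<^sub>v v) = v \<bullet> (S *\<^sub>v ?w)"
      using transpose_vec_mult_scalar[OF S w v(1)] sym comm_scalar_prod[of "S *\<^sub>v v" n ?w] S v w by simp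
    also have "\<dots> = Re (\<Sum>i<n. of_real (d i) * cnj (q v i) * (\<Sum>j\<in>{i..<n}. T $$ (i,j) * q v j))"
      unfolding form[OF v(1) w] by (intro arg_cong[where f=Re] sum.cong refl) (simp add: qw)
    also have "\<dots> \<le> - \<eta> * (\<Sum>i<n. (cmod (q v i))\<^sup>2)" by (rule W)
    also have "\<dots> < 0" using \<eta> q_ne[OF v] by simp
    finally show "v \<bullet> (?L *\<^sub>v v) < 0" unfolding lyapunov_form[OF A S sym v(1)] by simp
  qed
  then show ?thesis using S Spos by auto
qed


subsection \<open>Stabilization from data of full row rank\<close>

text \<open>A maximal independent set of columns has m elements and is therefore a basis, so every
  unit vector is the image of some vector; these preimages are the columns of the inverse.\<close>

lemma full_row_rank_right_inverse:
  fixes R :: "'a :: field mat"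
  assumes R: "R \<in> carrier_mat m k" and rk: "vec_space.rank m R = m"
  shows "\<exists>Y \<in> carrier_mat k m. R * Y = 1\<^sub>m m"
proof -
  interpret vec_space "TYPE('a)" m .
  have sub: "set (cols R) \<subseteq> carrier_vec m" using R cols_dim by blast
  obtain S where S: "maximal S (\<lambda>T. T \<subseteq> set (cols R) \<and> lin_indpt T)"
    using maximal_exists_superset[of "set (cols R)" "\<lambda>T. T \<subseteq> set (cols R) \<and> lin_indpt T" "{}"]
      lin_dep_def by auto
  then have SR: "S \<subseteq> set (cols R)" and Sli: "lin_indpt S" unfolding maximal_def by auto
  have "card S = m" using rank_card_indpt[OF R S] rk by simp
  then have "basis S"
    using dim_li_is_basis[of S] SR Sli sub finite_subset[OF SR] dim_is_n fin_dim by auto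
  then have "span S = carrier_vec m" unfolding basis_def by auto
  then have sp: "col_space R = carrier_vec m"
    unfolding col_space_def using span_is_monotone[OF SR] span_is_subset2[of "set (cols R)"] sub by auto
  have "\<exists>y \<in> carrier_vec k. R *\<^sub>v y = unit_vec m j" for j
    using sp R unfolding col_space_eq[OF R] by (auto simp: set_eq_iff)
  then obtain y where y: "\<And>j. y j \<in> carrier_vec k" "\<And>j. R *\<^sub>v y j = unit_vec m j" by metis
  let ?Y = "mat k m (\<lambda>(i,j). y j $ i)"
  have col: "col ?Y j = y j" if "j < m" for j
    using y(1)[of j] that by (intro eq_vecI) auto
  have "R * ?Y = 1\<^sub>m m"
  proof (rule eq_matI)
    fix i j assume "i < dim_row (1\<^sub>m m :: 'a mat)" "j < dim_col (1\<^sub>m m :: 'a mat)"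
    then have ij: "i < m" "j < m" by auto
    have "(R * ?Y) $$ (i,j) = (R *\<^sub>v y j) $ i" using ij R col by simp
    then show "(R * ?Y) $$ (i,j) = 1\<^sub>m m $$ (i,j)" using y ij by simp
  qed (use R in auto)
  then show ?thesis by (intro bexI[of _ ?Y]) auto
qed

lemma append_rows_mult:
  fixes P U Y :: "'a :: comm_ring_1 mat"
  assumes P: "P \<in> carrier_mat m k" and U: "U \<in> carrier_mat l k" and Y: "Y \<in> carrier_mat k r"
  shows "(P @\<^sub>r U) * Y = (P * Y) @\<^sub>r (U * Y)"
proof (rule eq_matI)
  fix i j assume "i < dim_row ((P * Y) @\<^sub>r (U * Y))" "j < dim_col ((P * Y) @\<^sub>r (U * Y))"
  then have ij: "i < m + l" "j < r" using P U Y by (auto simp: append_rows_def)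
  have "row (P @\<^sub>r U) i = (if i < m then row P i else row U (i - m))"
    using ij P U by (intro eq_vecI) (auto simp: append_rows_def)
  then show "((P @\<^sub>r U) * Y) $$ (i,j) = ((P * Y) @\<^sub>r (U * Y)) $$ (i,j)"
    using ij P U Y by (auto simp: append_rows_def)
qed (use P U Y in \<open>auto simp: append_rows_def\<close>)

lemma append_rows_inj:
  assumes "P \<in> carrier_mat m k" "P' \<in> carrier_mat m k" "U \<in> carrier_mat l k" "U' \<in> carrier_mat l k"
    and eq: "P @\<^sub>r U = P' @\<^sub>r U'"
  shows "P = P'" "U = U'"
proof -
  have *: "(P @\<^sub>r U) $$ (i,j) = (P' @\<^sub>r U') $$ (i,j)" for i j using eq by simp
  show "P = P'"
  proof (rule eq_matI)
    fix i j assume "i < dim_row P'" "j < dim_col P'"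
    then show "P $$ (i,j) = P' $$ (i,j)" using *[of i j] assms(1-4) by (auto simp: append_rows_def)
  qed (use assms in auto)
  show "U = U'"
  proof (rule eq_matI)
    fix i j assume "i < dim_row U'" "j < dim_col U'"
    then show "U $$ (i,j) = U' $$ (i,j)" using *[of "m + i" j] assms(1-4) by (auto simp: append_rows_def)
  qed (use assms in auto)
qed

text \<open>Once \<open>Z * transpose_mat P\<close> is known to be symmetric, the second condition
  on \<open>Z\<close> speaks of twice this matrix.\<close>

lemma pos_def_add_self_iff:
  assumes S: "S \<in> carrier_mat n n" and sym: "transpose_mat S = S"
  shows "pos_def (S + S) \<longleftrightarrow> pos_def S"
proof -
  have "v \<bullet> ((S + S) *\<^sub>v v) = 2 * (v \<bullet> (S *\<^sub>v v))" if "v \<in> carrier_vec n" for v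
  proof -
    have "(S + S) *\<^sub>v v = S *\<^sub>v v + S *\<^sub>v v"
      using S that by (simp add: add_mult_distrib_mat_vec[of _ n n])
    moreover have "v \<bullet> (S *\<^sub>v v + S *\<^sub>v v) = v \<bullet> (S *\<^sub>v v) + v \<bullet> (S *\<^sub>v v)"
      by (rule scalar_prod_add_distrib[of _ n]) (use S that in auto)
    ultimately show ?thesis by simp
  qed
  moreover have "transpose_mat (S + S) = S + S"
    using transpose_add[OF S S] sym by simp
  ultimately show ?thesis using S sym unfolding pos_def_def by auto
qed

text \<open>Both directions rest on \<^term>\<open>D * transpose_mat Z = (A + B * K) * S\<close> with
  \<^term>\<open>S = Z * transpose_mat P\<close>, which turns the first condition into a Lyapunov inequality.\<close>

lemma data_driven_stabilization:
  fixes A B D P U :: "real mat"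
  assumes A: "A \<in> carrier_mat m m" and B: "B \<in> carrier_mat m l"
    and P: "P \<in> carrier_mat m k" and U: "U \<in> carrier_mat l k"
    and D: "D = A * P + B * U"
    and rk: "vec_space.rank (m + l) (P @\<^sub>r U) = m + l"
  defines "feasible \<equiv> \<lambda>Z. neg_def (D * transpose_mat Z + Z * transpose_mat D) \<and>
            pos_def (Z * transpose_mat P + P * transpose_mat Z) \<and>
            Z * transpose_mat P - P * transpose_mat Z = 0\<^sub>m m m"
  shows "Z \<in> carrier_mat m k \<Longrightarrow> feasible Z \<Longrightarrow> invertible_mat (Z * transpose_mat P) \<and>
            hurwitz (A + B * (U * transpose_mat Z * mat_inv (Z * transpose_mat P)))"
    and "K \<in> carrier_mat l m \<Longrightarrow> hurwitz (A + B * K) \<Longrightarrow>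
            \<exists>Z \<in> carrier_mat m k. feasible Z \<and> K = U * transpose_mat Z * mat_inv (Z * transpose_mat P)"
proof -
  have Dc: "D \<in> carrier_mat m k" unfolding D using A B P U by auto
  have DZ: "D * transpose_mat Z = (A + B * K) * S"
    if Z: "Z \<in> carrier_mat m k" and K: "K \<in> carrier_mat l m" and S: "S \<in> carrier_mat m m"
      and PZ: "P * transpose_mat Z = S" and UZ: "U * transpose_mat Z = K * S" for Z K S
  proof -
    have Zt: "transpose_mat Z \<in> carrier_mat k m" using Z by auto
    have "D * transpose_mat Z = A * P * transpose_mat Z + B * U * transpose_mat Z"
      unfolding D by (rule add_mult_distrib_mat[of _ m k]) (use A B P U Zt in auto)
    also have "\<dots> = A * (P * transpose_mat Z) + B * (U * transpose_mat Z)"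
      using A B P U Zt by (simp add: assoc_mult_mat[of _ m m _ k _ m] assoc_mult_mat[of _ m l _ k _ m])
    also have "\<dots> = A * S + B * K * S"
      unfolding PZ UZ using B K S by simp
    also have "\<dots> = (A + B * K) * S"
      by (rule add_mult_distrib_mat[symmetric, of _ m m]) (use A B K S in auto)
    finally show ?thesis .
  qed
  have ZD: "Z * transpose_mat D = S * transpose_mat C"
    if Z: "Z \<in> carrier_mat m k" and C: "C \<in> carrier_mat m m" and S: "S \<in> carrier_mat m m"
      and sym: "transpose_mat S = S" and "D * transpose_mat Z = C * S" for Z C S
  proof -
    have "Z * transpose_mat D = transpose_mat (D * transpose_mat Z)"
      using Z Dc by (simp add: transpose_mult[of _ m k _ m])
    then show ?thesis using that by (simp add: transpose_mult[of _ m m _ m])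
  qed
  have PZ: "P * transpose_mat Z = transpose_mat (Z * transpose_mat P)" if "Z \<in> carrier_mat m k" for Z
    using P that by (simp add: transpose_mult[of _ m k _ m])
  show "invertible_mat (Z * transpose_mat P) \<and>
            hurwitz (A + B * (U * transpose_mat Z * mat_inv (Z * transpose_mat P)))"
    if Z: "Z \<in> carrier_mat m k" and f: "feasible Z" for Z
  proof -
    define S where "S = Z * transpose_mat P"
    have S: "S \<in> carrier_mat m m" using Z P by (auto simp: S_def)
    \<comment> \<open>Since \<open>P * transpose_mat Z\<close> is the transpose of \<open>S\<close>,
      the third condition is symmetry of \<open>S\<close>. It has to come first: only then does the
      second condition become positive definiteness of \<open>S\<close>.\<close>
    have "S - transpose_mat S = 0\<^sub>m m m" using f PZ[OF Z] unfolding feasible_def S_def by simp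
    then have ent: "(S - transpose_mat S) $$ (i,j) = 0" if "i < m" "j < m" for i j using that by simp
    have sym: "transpose_mat S = S"
      by (rule eq_matI) (use ent S in auto)
    have pd: "pos_def S"
      using f PZ[OF Z] pos_def_add_self_iff[OF S sym] sym unfolding feasible_def S_def by simp
    note inv = mat_inv_inverse[OF S pos_def_det_nonzero[OF S pd]]
    define K where "K = U * transpose_mat Z * mat_inv S"
    have UZc: "U * transpose_mat Z \<in> carrier_mat l m" using U Z by auto
    have K: "K \<in> carrier_mat l m" using UZc inv(3) unfolding K_def by auto
    have "K * S = U * transpose_mat Z"
      unfolding K_def using assoc_mult_mat[OF UZc inv(3) S] inv(2) right_mult_one_mat[OF UZc] by simp
    from DZ[OF Z K S _ this[symmetric]] have DZ': "D * transpose_mat Z = (A + B * K) * S"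
      using PZ[OF Z] sym S_def by simp
    have C: "A + B * K \<in> carrier_mat m m" using A B K by auto
    have "hurwitz (A + B * K)"
      by (rule lyapunov_imp_hurwitz[OF C S pd])
        (use f ZD[OF Z C S sym DZ'] DZ' in \<open>simp add: feasible_def\<close>)
    moreover have "invertible_mat S"
      using inv S unfolding invertible_mat_def inverts_mat_def by auto
    ultimately show ?thesis unfolding K_def S_def by simp
  qed
  show "\<exists>Z \<in> carrier_mat m k. feasible Z \<and> K = U * transpose_mat Z * mat_inv (Z * transpose_mat P)"
    if K: "K \<in> carrier_mat l m" and h: "hurwitz (A + B * K)" for K
  proof -
    have C: "A + B * K \<in> carrier_mat m m" using A B K by auto
    from hurwitz_imp_lyapunov[OF C h] obtain S where S: "S \<in> carrier_mat m m" and pd: "pos_def S"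
      and nd: "neg_def ((A + B * K) * S + S * transpose_mat (A + B * K))" by auto
    have sym: "transpose_mat S = S" using pd unfolding pos_def_def by auto
    have R: "P @\<^sub>r U \<in> carrier_mat (m + l) k" using P U by auto
    obtain Y where Y: "Y \<in> carrier_mat k (m + l)" and RY: "(P @\<^sub>r U) * Y = 1\<^sub>m (m + l)"
      using full_row_rank_right_inverse[OF R rk] by auto
    have KS: "K * S \<in> carrier_mat l m" using K S by auto
    have F: "S @\<^sub>r (K * S) \<in> carrier_mat (m + l) m" using S KS by auto
    \<comment> \<open>The transpose of \<open>Z\<close> must be mapped by \<open>P\<close> to
      \<open>S\<close> and by \<open>U\<close> to \<open>K * S\<close>. Stacked, this is one linear
      system with matrix \<open>P @\<^sub>r U\<close>, solved by the right inverse
      \<open>Y\<close>.\<close>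
    define Z where "Z = transpose_mat (Y * (S @\<^sub>r (K * S)))"
    have Z: "Z \<in> carrier_mat m k" using Y F by (auto simp: Z_def)
    have Zt: "transpose_mat Z = Y * (S @\<^sub>r (K * S))" by (simp add: Z_def)
    have "(P @\<^sub>r U) * transpose_mat Z = S @\<^sub>r (K * S)"
      unfolding Zt using assoc_mult_mat[OF R Y F] RY F by simp
    then have eq: "(P * transpose_mat Z) @\<^sub>r (U * transpose_mat Z) = S @\<^sub>r (K * S)"
      using append_rows_mult[OF P U, of "transpose_mat Z" m] Z by simp
    have UZ: "U * transpose_mat Z = K * S" and PZS: "P * transpose_mat Z = S"
      using append_rows_inj[OF _ S _ KS eq] P U Z by auto
    have ZP: "Z * transpose_mat P = S"
      using PZ[OF Z] PZS sym by (metis transpose_transpose)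
    note DZ' = DZ[OF Z K S PZS UZ]
    have "feasible Z" unfolding feasible_def
      using nd DZ' ZD[OF Z C S sym DZ'] ZP PZS pos_def_add_self_iff[OF S sym] pd S by auto
    moreover have "K = U * transpose_mat Z * mat_inv (Z * transpose_mat P)"
      unfolding ZP UZ using mat_inv_inverse[OF S pos_def_det_nonzero[OF S pd]] K S
      by (simp add: assoc_mult_mat[of _ l m _ m _ m])
    ultimately show ?thesis using Z by blast
  qed
qed

subsection \<open>Linear integral equations\<close>

text \<open>The integral form of "x has derivative f and starts at x0". The integrand is free rather
  than tied to a system matrix, so that such relations can be added, multiplied by matrices and
  stacked; the dimension of f is recorded because these operations need it.\<close>

definition vec_integral :: "nat \<Rightarrow> real \<Rightarrow> (real \<Rightarrow> real vec) \<Rightarrow> real vec \<Rightarrow> (real \<Rightarrow> real vec) \<Rightarrow> bool" where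
  "vec_integral m T f x0 x \<longleftrightarrow> x0 \<in> carrier_vec m \<and>
     (\<forall>t\<in>{0..T}. x t \<in> carrier_vec m \<and> f t \<in> carrier_vec m \<and>
        (\<forall>i<m. ((\<lambda>s. f s $ i) has_integral (x t $ i - x0 $ i)) {0..t}))"

lemma vec_integral_cong:
  assumes "vec_integral m T f x0 x"
    and "\<And>s. s \<in> {0..T} \<Longrightarrow> f s = g s" and "\<And>s. s \<in> {0..T} \<Longrightarrow> x s = y s" and "x0 = y0"
  shows "vec_integral m T g y0 y"
  unfolding vec_integral_def
proof (intro conjI ballI allI impI)
  show "y0 \<in> carrier_vec m" using assms by (auto simp: vec_integral_def)
  fix t assume t: "t \<in> {0..T}"
  show "y t \<in> carrier_vec m" "g t \<in> carrier_vec m"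
    using assms t by (auto simp: vec_integral_def)
  fix i assume i: "i < m"
  have "((\<lambda>s. f s $ i) has_integral (x t $ i - x0 $ i)) {0..t}"
    using assms(1) t i by (auto simp: vec_integral_def)
  then show "((\<lambda>s. g s $ i) has_integral (y t $ i - y0 $ i)) {0..t}"
    using assms(2-4) t by (auto intro: has_integral_eq[rotated])
qed

lemma vec_integral_of_lin_ode_sol:
  assumes "lin_ode_sol M g x0 T x" and M: "M \<in> carrier_mat m m"
    and g: "\<And>s. s \<in> {0..T} \<Longrightarrow> g s \<in> carrier_vec m"
  shows "vec_integral m T (\<lambda>s. M *\<^sub>v x s + g s) x0 x"
  unfolding vec_integral_def
proof (intro conjI ballI allI impI)
  show "x0 \<in> carrier_vec m" using assms by (auto simp: lin_ode_sol_def)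
  fix t assume t: "t \<in> {0..T}"
  have dim: "dim_vec (g s) = m" if "0 \<le> s" "s \<le> t" for s
    using g[of s] t that by (auto simp: carrier_vecD)
  show "x t \<in> carrier_vec m" "M *\<^sub>v x t + g t \<in> carrier_vec m"
    using assms(1) M g[OF t] t by (auto simp: lin_ode_sol_def)
  fix i assume i: "i < m"
  have "((\<lambda>s. (M *\<^sub>v x s) $ i + g s $ i) has_integral (x t $ i - x0 $ i)) {0..t}"
    using assms(1) M t i by (auto simp: lin_ode_sol_def)
  then show "((\<lambda>s. (M *\<^sub>v x s + g s) $ i) has_integral (x t $ i - x0 $ i)) {0..t}"
    by (rule has_integral_eq[rotated]) (use dim i in auto)
qed

lemma vec_integral_add:
  assumes f: "vec_integral m T f x0 x" and g: "vec_integral m T g y0 y"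
  shows "vec_integral m T (\<lambda>s. f s + g s) (x0 + y0) (\<lambda>s. x s + y s)"
  unfolding vec_integral_def
proof (intro conjI ballI allI impI)
  show "x0 + y0 \<in> carrier_vec m" using f g by (auto simp: vec_integral_def)
  fix t assume t: "t \<in> {0..T}"
  have dim: "dim_vec (g s) = m" if "0 \<le> s" "s \<le> t" for s
    using g t that by (auto simp: vec_integral_def carrier_vecD)
  have dim': "dim_vec (y t) = m" "dim_vec y0 = m"
    using g t by (auto simp: vec_integral_def carrier_vecD)
  show "x t + y t \<in> carrier_vec m" "f t + g t \<in> carrier_vec m"
    using f g t by (auto simp: vec_integral_def)
  fix i assume i: "i < m"
  have "((\<lambda>s. f s $ i + g s $ i) has_integral ((x t $ i - x0 $ i) + (y t $ i - y0 $ i))) {0..t}"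
    using f g t i by (intro has_integral_add) (auto simp: vec_integral_def)
  moreover have "(x t $ i - x0 $ i) + (y t $ i - y0 $ i) = (x t + y t) $ i - (x0 + y0) $ i"
    using dim' i by simp
  ultimately have "((\<lambda>s. f s $ i + g s $ i) has_integral ((x t + y t) $ i - (x0 + y0) $ i)) {0..t}"
    by simp
  then show "((\<lambda>s. (f s + g s) $ i) has_integral ((x t + y t) $ i - (x0 + y0) $ i)) {0..t}"
    by (rule has_integral_eq[rotated]) (use dim i in auto)
qed

lemma vec_integral_mult_mat:
  assumes f: "vec_integral m T f x0 x" and P: "P \<in> carrier_mat k m"
  shows "vec_integral k T (\<lambda>s. P *\<^sub>v f s) (P *\<^sub>v x0) (\<lambda>s. P *\<^sub>v x s)"
  unfolding vec_integral_def
proof (intro conjI ballI allI impI)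
  show "P *\<^sub>v x0 \<in> carrier_vec k" using f P by (auto simp: vec_integral_def)
  fix t assume t: "t \<in> {0..T}"
  show "P *\<^sub>v x t \<in> carrier_vec k" "P *\<^sub>v f t \<in> carrier_vec k"
    using f P t by (auto simp: vec_integral_def)
  fix i assume i: "i < k"
  have mv: "(P *\<^sub>v v) $ i = (\<Sum>j<m. P $$ (i,j) * v $ j)" if "v \<in> carrier_vec m" for v
    using that P i by (simp add: scalar_prod_def lessThan_atLeast0)
  have "((\<lambda>s. \<Sum>j<m. P $$ (i,j) * f s $ j) has_integral (\<Sum>j<m. P $$ (i,j) * (x t $ j - x0 $ j))) {0..t}"
    using f t by (intro has_integral_sum has_integral_mult_right) (auto simp: vec_integral_def)
  moreover have "(\<Sum>j<m. P $$ (i,j) * (x t $ j - x0 $ j)) = (P *\<^sub>v x t) $ i - (P *\<^sub>v x0) $ i"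
    using f t by (auto simp: mv vec_integral_def right_diff_distrib sum_subtractf)
  ultimately have "((\<lambda>s. \<Sum>j<m. P $$ (i,j) * f s $ j) has_integral ((P *\<^sub>v x t) $ i - (P *\<^sub>v x0) $ i)) {0..t}"
    by simp
  then show "((\<lambda>s. (P *\<^sub>v f s) $ i) has_integral ((P *\<^sub>v x t) $ i - (P *\<^sub>v x0) $ i)) {0..t}"
    by (rule has_integral_eq[rotated]) (use f t in \<open>auto simp: mv vec_integral_def\<close>)
qed

lemma vec_integral_smult:
  assumes f: "vec_integral m T f x0 x"
  shows "vec_integral m T (\<lambda>s. k \<cdot>\<^sub>v f s) (k \<cdot>\<^sub>v x0) (\<lambda>s. k \<cdot>\<^sub>v x s)"
proof (rule vec_integral_cong[OF vec_integral_mult_mat[OF f, of "k \<cdot>\<^sub>m 1\<^sub>m m" m]])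
  have *: "k \<cdot>\<^sub>m 1\<^sub>m m *\<^sub>v v = k \<cdot>\<^sub>v v" if "v \<in> carrier_vec m" for v
    using that by (intro eq_vecI) auto
  show "k \<cdot>\<^sub>m 1\<^sub>m m *\<^sub>v x0 = k \<cdot>\<^sub>v x0" using f * by (auto simp: vec_integral_def)
  fix s assume "s \<in> {0..T}"
  then show "k \<cdot>\<^sub>m 1\<^sub>m m *\<^sub>v f s = k \<cdot>\<^sub>v f s" "k \<cdot>\<^sub>m 1\<^sub>m m *\<^sub>v x s = k \<cdot>\<^sub>v x s"
    using f * by (auto simp: vec_integral_def)
qed auto

lemma vec_integral_scalar:
  assumes f: "\<And>t. t \<in> {0..T} \<Longrightarrow> (f has_integral y t) {0..t}" and v: "v \<in> carrier_vec m"
  shows "vec_integral m T (\<lambda>s. f s \<cdot>\<^sub>v v) (0\<^sub>v m) (\<lambda>s. y s \<cdot>\<^sub>v v)"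
  unfolding vec_integral_def
proof (intro conjI ballI allI impI)
  fix t i assume "t \<in> {0..T}" "i < m"
  then show "((\<lambda>s. (f s \<cdot>\<^sub>v v) $ i) has_integral (y t \<cdot>\<^sub>v v) $ i - 0\<^sub>v m $ i) {0..t}"
    using has_integral_mult_left[OF f, of t "v $ i"] v by simp
qed (use v in auto)

lemma vec_integral_append:
  assumes f: "vec_integral m T f x0 x" and g: "vec_integral k T g y0 y"
  shows "vec_integral (m + k) T (\<lambda>s. f s @\<^sub>v g s) (x0 @\<^sub>v y0) (\<lambda>s. x s @\<^sub>v y s)"
  unfolding vec_integral_def
proof (intro conjI ballI allI impI)
  show "x0 @\<^sub>v y0 \<in> carrier_vec (m + k)" using f g by (auto simp: vec_integral_def)
  fix t assume t: "t \<in> {0..T}"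
  show "x t @\<^sub>v y t \<in> carrier_vec (m + k)" "f t @\<^sub>v g t \<in> carrier_vec (m + k)"
    using f g t by (auto simp: vec_integral_def)
  have dim: "dim_vec (f s) = m" "dim_vec (g s) = k" if "0 \<le> s" "s \<le> t" for s
    using f g t that by (auto simp: vec_integral_def carrier_vecD)
  have dim': "dim_vec (x t) = m" "dim_vec (y t) = k" "dim_vec x0 = m" "dim_vec y0 = k"
    using f g t by (auto simp: vec_integral_def carrier_vecD)
  fix i assume i: "i < m + k"
  have "((\<lambda>s. if i < m then f s $ i else g s $ (i - m)) has_integral
      ((x t @\<^sub>v y t) $ i - (x0 @\<^sub>v y0) $ i)) {0..t}"
  proof -
    have "(x t @\<^sub>v y t) $ i = (if i < m then x t $ i else y t $ (i - m))"
      "(x0 @\<^sub>v y0) $ i = (if i < m then x0 $ i else y0 $ (i - m))"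
      using dim' i by simp_all
    then show ?thesis using f g t i by (auto simp: vec_integral_def)
  qed
  then show "((\<lambda>s. (f s @\<^sub>v g s) $ i) has_integral ((x t @\<^sub>v y t) $ i - (x0 @\<^sub>v y0) $ i)) {0..t}"
    by (rule has_integral_eq[rotated]) (use dim i in auto)
qed

lemma vec_integral_FTC:
  fixes x f :: "real \<Rightarrow> real vec"
  assumes "\<And>s. s \<in> {0..T} \<Longrightarrow> x s \<in> carrier_vec m" "\<And>s. s \<in> {0..T} \<Longrightarrow> f s \<in> carrier_vec m"
    and "x0 \<in> carrier_vec m" and "x 0 = x0"
    and d: "\<And>i s. i < m \<Longrightarrow> s \<in> {0..T} \<Longrightarrow> ((\<lambda>s. x s $ i) has_real_derivative f s $ i) (at s)"
  shows "vec_integral m T f x0 x"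
  unfolding vec_integral_def
proof (intro conjI ballI allI impI)
  fix t i assume t: "t \<in> {0..T}" and i: "i < m"
  have "((\<lambda>s. f s $ i) has_integral (x t $ i - x 0 $ i)) {0..t}"
  proof (rule fundamental_theorem_of_calculus)
    show "0 \<le> t" using t by auto
    fix s assume "s \<in> {0..t}"
    then show "((\<lambda>s. x s $ i) has_vector_derivative f s $ i) (at s within {0..t})"
      using d[OF i, of s] t
      by (auto simp: has_real_derivative_iff_has_vector_derivative[symmetric] intro: has_field_derivative_at_within)
  qed
  then show "((\<lambda>s. f s $ i) has_integral (x t $ i - x0 $ i)) {0..t}" using assms(4) by simp
qed (use assms in auto)

text \<open>Gronwall's argument: the sum g of absolute components is bounded by K times its own
  integral G, hence exp (- K t) G t does not increase. It starts at 0 and cannot become negative, so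
  G and then g vanish.\<close>

lemma linear_integral_equation_zero:
  assumes x: "vec_integral m T (\<lambda>s. M *\<^sub>v x s) (0\<^sub>v m) x" and M: "M \<in> carrier_mat m m"
    and t: "t \<in> {0..T}"
  shows "x t = 0\<^sub>v m"
proof -
  have xc: "x s \<in> carrier_vec m" if "s \<in> {0..T}" for s using x that by (auto simp: vec_integral_def)
  have xi: "((\<lambda>s. (M *\<^sub>v x s) $ i) has_integral x s $ i) {0..s}" if "i < m" "s \<in> {0..T}" for i s
    using x that by (auto simp: vec_integral_def)
  have T: "T \<in> {0..T}" using t by auto
  \<comment> \<open>Continuity is not assumed: each component is an indefinite integral. It makes G
    differentiable with derivative g.\<close>
  have cont: "continuous_on {0..T} (\<lambda>s. x s $ i)" if "i < m" for i
  proof -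
    have "continuous_on {0..T} (\<lambda>s. integral {0..s} (\<lambda>s. (M *\<^sub>v x s) $ i))"
      using xi[OF that T] by (intro indefinite_integral_continuous_1) (auto simp: integrable_on_def)
    moreover have "integral {0..s} (\<lambda>s. (M *\<^sub>v x s) $ i) = x s $ i" if "s \<in> {0..T}" for s
      using xi[OF \<open>i < m\<close> that] by (rule integral_unique)
    ultimately show ?thesis by (rule continuous_on_eq)
  qed
  have mv: "(M *\<^sub>v x s) $ i = (\<Sum>j<m. M $$ (i,j) * x s $ j)" if "i < m" "s \<in> {0..T}" for i s
    using M xc[OF that(2)] that by (simp add: scalar_prod_def lessThan_atLeast0)
  define g where "g s = (\<Sum>i<m. \<bar>x s $ i\<bar>)" for s
  have g_cont: "continuous_on {0..T} g"
    unfolding g_def using cont by (intro continuous_intros) auto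
  define K where "K = (\<Sum>i<m. \<Sum>j<m. \<bar>M $$ (i,j)\<bar>)"
  define G where "G s = integral {0..s} g" for s
  have g_nonneg: "g s \<ge> 0" for s unfolding g_def by (intro sum_nonneg) auto
  have Mg: "(\<Sum>i<m. \<bar>(M *\<^sub>v x s) $ i\<bar>) \<le> K * g s" if "s \<in> {0..T}" for s
  proof -
    have "\<bar>(M *\<^sub>v x s) $ i\<bar> \<le> (\<Sum>j<m. \<bar>M $$ (i,j)\<bar>) * g s" if i: "i < m" for i
    proof -
      have "\<bar>(M *\<^sub>v x s) $ i\<bar> \<le> (\<Sum>j<m. \<bar>M $$ (i,j)\<bar> * \<bar>x s $ j\<bar>)"
        unfolding mv[OF i \<open>s \<in> {0..T}\<close>] by (rule order_trans[OF sum_abs]) (simp add: abs_mult)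
      also have "\<dots> \<le> (\<Sum>j<m. \<bar>M $$ (i,j)\<bar> * g s)"
        unfolding g_def by (intro sum_mono mult_left_mono member_le_sum) auto
      finally show ?thesis by (simp add: sum_distrib_right)
    qed
    then have "(\<Sum>i<m. \<bar>(M *\<^sub>v x s) $ i\<bar>) \<le> (\<Sum>i<m. (\<Sum>j<m. \<bar>M $$ (i,j)\<bar>) * g s)"
      by (intro sum_mono) auto
    then show ?thesis unfolding K_def by (simp add: sum_distrib_right)
  qed
  have g_int: "g integrable_on {0..s}" if "s \<in> {0..T}" for s
    using that by (intro integrable_continuous_real continuous_on_subset[OF g_cont]) auto
  have gG: "g s \<le> K * G s" if s: "s \<in> {0..T}" for s
  proof -
    have Mx_cont: "continuous_on {0..s} (\<lambda>r. (M *\<^sub>v x r) $ i)" if "i < m" for i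
    proof -
      have "continuous_on {0..s} (\<lambda>r. \<Sum>j<m. M $$ (i,j) * x r $ j)"
        using s by (intro continuous_intros continuous_on_subset[OF cont]) auto
      then show ?thesis by (rule continuous_on_eq) (use mv[OF that] s in auto)
    qed
    have abs_int: "(\<lambda>r. \<bar>(M *\<^sub>v x r) $ i\<bar>) integrable_on {0..s}" if "i < m" for i
      using Mx_cont[OF that] by (intro integrable_continuous_real continuous_intros)
    have "\<bar>x s $ i\<bar> \<le> integral {0..s} (\<lambda>r. \<bar>(M *\<^sub>v x r) $ i\<bar>)" if i: "i < m" for i
    proof -
      have "norm (integral {0..s} (\<lambda>r. (M *\<^sub>v x r) $ i)) \<le> integral {0..s} (\<lambda>r. \<bar>(M *\<^sub>v x r) $ i\<bar>)"
        using xi[OF i s] abs_int[OF i] by (intro integral_norm_bound_integral) auto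
      then show ?thesis using integral_unique[OF xi[OF i s]] by simp
    qed
    then have "g s \<le> (\<Sum>i<m. integral {0..s} (\<lambda>r. \<bar>(M *\<^sub>v x r) $ i\<bar>))"
      unfolding g_def by (intro sum_mono) auto
    also have "\<dots> = integral {0..s} (\<lambda>r. \<Sum>i<m. \<bar>(M *\<^sub>v x r) $ i\<bar>)"
      using abs_int by (intro integral_sum[symmetric]) auto
    also have "\<dots> \<le> integral {0..s} (\<lambda>r. K * g r)"
      using abs_int Mg s g_int[OF s] by (intro integral_le integrable_sum integrable_on_mult_right) auto
    also have "\<dots> = K * G s" unfolding G_def by simp
    finally show ?thesis .
  qed
  have G_nonneg: "G s \<ge> 0" if "s \<in> {0..T}" for s
    unfolding G_def using g_nonneg g_int[OF that] by (intro integral_nonneg) auto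
  have deriv: "((\<lambda>r. exp (- K * r) * G r) has_real_derivative exp (- K * s) * (g s - K * G s)) (at s within {0..T})"
    if s: "s \<in> {0..T}" for s
  proof -
    have "(G has_real_derivative g s) (at s within {0..T})"
      unfolding G_def by (rule integral_has_real_derivative[OF g_cont s])
    then show ?thesis by (auto intro!: derivative_eq_intros simp: algebra_simps)
  qed
  have "exp (- K * t) * G t \<le> exp (- K * 0) * G 0"
  proof (rule DERIV_nonpos_imp_decreasing_open[of 0 t])
    show "0 \<le> t" using t by auto
    show "continuous_on {0..t} (\<lambda>r. exp (- K * r) * G r)"
      by (rule continuous_on_subset[OF DERIV_continuous_on[OF deriv]]) (use t in auto)
    fix s assume s: "0 < s" "s < t"
    then have sT: "s \<in> {0..T}" and int: "s \<in> interior {0..T}" using t by (auto simp: interior_atLeastAtMost_real)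
    have "((\<lambda>r. exp (- K * r) * G r) has_real_derivative exp (- K * s) * (g s - K * G s)) (at s)"
      using deriv[OF sT] at_within_interior[OF int] by simp
    moreover have "exp (- K * s) * (g s - K * G s) \<le> 0"
      using gG[OF sT] by (simp add: mult_le_0_iff)
    ultimately show "\<exists>y. ((\<lambda>r. exp (- K * r) * G r) has_real_derivative y) (at s) \<and> y \<le> 0"
      by blast
  qed
  then have "G t \<le> 0" by (simp add: G_def mult_le_0_iff)
  then have "G t = 0" using G_nonneg[OF t] by simp
  then have "g t = 0" using gG[OF t] g_nonneg[of t] by simp
  then have "\<forall>i<m. x t $ i = 0" unfolding g_def by (subst (asm) sum_nonneg_eq_0_iff) auto
  then show ?thesis using xc[OF t] by (intro eq_vecI) auto
qed

text \<open>The forcing cancels in the difference, which solves the homogeneous equation from zero.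
  For this reason \<open>g\<close> may itself contain one of the signals under study, such as the
  plant output.\<close>

lemma linear_integral_equation_unique:
  assumes x: "vec_integral m T (\<lambda>s. M *\<^sub>v x s + g s) x0 x"
    and y: "vec_integral m T (\<lambda>s. M *\<^sub>v y s + g s) x0 y"
    and M: "M \<in> carrier_mat m m" and g: "\<And>s. s \<in> {0..T} \<Longrightarrow> g s \<in> carrier_vec m"
    and t: "t \<in> {0..T}"
  shows "x t = y t"
proof -
  have xc: "x s \<in> carrier_vec m" "y s \<in> carrier_vec m" if "s \<in> {0..T}" for s
    using x y that by (auto simp: vec_integral_def)
  have x0: "x0 \<in> carrier_vec m" using x by (auto simp: vec_integral_def)
  have "vec_integral m T (\<lambda>s. M *\<^sub>v (x s + (-1) \<cdot>\<^sub>v y s)) (0\<^sub>v m) (\<lambda>s. x s + (-1) \<cdot>\<^sub>v y s)"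
  proof (rule vec_integral_cong[OF vec_integral_add[OF x vec_integral_smult[OF y, of "-1"]]])
    show "x0 + (-1) \<cdot>\<^sub>v x0 = 0\<^sub>v m" using x0 by (intro eq_vecI) auto
    fix s assume s: "s \<in> {0..T}"
    have "M *\<^sub>v (x s + (-1) \<cdot>\<^sub>v y s) = M *\<^sub>v x s + (-1) \<cdot>\<^sub>v (M *\<^sub>v y s)"
      using M xc[OF s] by (simp add: mult_add_distrib_mat_vec[of _ m m] mult_mat_vec[of _ m m])
    then show "M *\<^sub>v x s + g s + (-1) \<cdot>\<^sub>v (M *\<^sub>v y s + g s) = M *\<^sub>v (x s + (-1) \<cdot>\<^sub>v y s)"
      using g[OF s] M by (intro eq_vecI) (auto simp: carrier_vecD)
  qed auto
  then have "x t + (-1) \<cdot>\<^sub>v y t = 0\<^sub>v m"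
    by (rule linear_integral_equation_zero[OF _ M t])
  then have "(x t + (-1) \<cdot>\<^sub>v y t) $ i = 0" if "i < m" for i using that by simp
  then show ?thesis using xc[OF t] by (intro eq_vecI) (auto simp: carrier_vecD)
qed

subsection \<open>Matrix exponential\<close>

lemma pow_mat_smult:
  fixes M :: "'a :: comm_ring_1 mat"
  assumes M: "M \<in> carrier_mat n n"
  shows "(t \<cdot>\<^sub>m M) ^\<^sub>m k = t ^ k \<cdot>\<^sub>m (M ^\<^sub>m k)"
proof (induction k)
  case 0
  show ?case using M by (auto intro!: eq_matI)
next
  case (Suc k)
  have "M ^\<^sub>m k \<in> carrier_mat n n" using M by (rule pow_carrier_mat)
  then show ?case using Suc M by (simp add: mult_smult_assoc_mat[of _ n n _ n] mult_smult_distrib[of _ n n _ n])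
    (auto intro!: eq_matI)
qed

text \<open>Powers grow by a factor on the right, whereas differentiating the exponential series is
  to bring out the matrix on the left.\<close>

lemma pow_mat_Suc_left:
  fixes M :: "'a :: comm_ring_1 mat"
  assumes M: "M \<in> carrier_mat n n"
  shows "M ^\<^sub>m Suc k = M * M ^\<^sub>m k"
proof (induction k)
  case 0
  show ?case using M by simp
next
  case (Suc k)
  have "M ^\<^sub>m Suc (Suc k) = M * M ^\<^sub>m k * M" using Suc by simp
  then show ?case using M pow_carrier_mat[OF M] by (simp add: assoc_mult_mat[of _ n n _ n _ n])
qed

text \<open>The sum of all absolute entries is a submultiplicative norm that dominates every single
  entry.\<close>

lemma pow_mat_entry_bound:
  fixes M :: "real mat"
  assumes M: "M \<in> carrier_mat n n" and "i < n" "j < n"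
  shows "\<bar>(M ^\<^sub>m k) $$ (i,j)\<bar> \<le> (\<Sum>i<n. \<Sum>j<n. \<bar>M $$ (i,j)\<bar>) ^ k"
  using assms(2,3)
proof (induction k arbitrary: i j)
  case 0
  then show ?case using M by simp
next
  case (Suc k)
  let ?B = "\<Sum>i<n. \<Sum>j<n. \<bar>M $$ (i,j)\<bar>"
  have B: "?B \<ge> 0" by (intro sum_nonneg) auto
  have "(M ^\<^sub>m Suc k) $$ (i,j) = (\<Sum>l<n. (M ^\<^sub>m k) $$ (i,l) * M $$ (l,j))"
    using M Suc.prems pow_carrier_mat[OF M, of k] by (simp add: scalar_prod_def lessThan_atLeast0)
  then have "\<bar>(M ^\<^sub>m Suc k) $$ (i,j)\<bar> \<le> (\<Sum>l<n. \<bar>(M ^\<^sub>m k) $$ (i,l)\<bar> * \<bar>M $$ (l,j)\<bar>)"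
    using sum_abs[of "\<lambda>l. (M ^\<^sub>m k) $$ (i,l) * M $$ (l,j)" "{..<n}"] by (simp add: abs_mult)
  also have "\<dots> \<le> (\<Sum>l<n. ?B ^ k * (\<Sum>j<n. \<bar>M $$ (l,j)\<bar>))"
    using Suc by (intro sum_mono mult_mono member_le_sum) (auto intro!: zero_le_power B)
  also have "\<dots> = ?B ^ Suc k" by (simp add: sum_distrib_left[symmetric])
  finally show ?case .
qed

text \<open>Seen entry by entry, the exponential is a real power series in t, dominated by the
  scalar exponential series; real termwise differentiation then applies without any norm on
  matrices.\<close>

lemma mat_exp_power_series:
  assumes M: "M \<in> carrier_mat n n" and ij: "i < n" "j < n"
  shows "summable (\<lambda>k. (M ^\<^sub>m k) $$ (i,j) / fact k * t ^ k)"
    and "mat_exp (t \<cdot>\<^sub>m M) $$ (i,j) = (\<Sum>k. (M ^\<^sub>m k) $$ (i,j) / fact k * t ^ k)"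
proof -
  let ?B = "\<Sum>i<n. \<Sum>j<n. \<bar>M $$ (i,j)\<bar>"
  show "summable (\<lambda>k. (M ^\<^sub>m k) $$ (i,j) / fact k * t ^ k)"
  proof (rule summable_comparison_test')
    show "summable (\<lambda>k. inverse (fact k) * (?B * \<bar>t\<bar>) ^ k)" by (rule summable_exp)
    fix k :: nat
    have "\<bar>(M ^\<^sub>m k) $$ (i,j)\<bar> * \<bar>t ^ k\<bar> \<le> ?B ^ k * \<bar>t ^ k\<bar>"
      by (intro mult_right_mono pow_mat_entry_bound[OF M ij]) auto
    then show "norm ((M ^\<^sub>m k) $$ (i,j) / fact k * t ^ k) \<le> inverse (fact k) * (?B * \<bar>t\<bar>) ^ k"
      by (simp add: abs_mult field_simps power_abs)
  qed
  have "((t \<cdot>\<^sub>m M) ^\<^sub>m k) $$ (i,j) / fact k = (M ^\<^sub>m k) $$ (i,j) / fact k * t ^ k" for k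
    using ij M pow_carrier_mat[OF M, of k] by (simp add: pow_mat_smult[OF M])
  then show "mat_exp (t \<cdot>\<^sub>m M) $$ (i,j) = (\<Sum>k. (M ^\<^sub>m k) $$ (i,j) / fact k * t ^ k)"
    using ij M by (simp add: mat_exp_def)
qed

lemma mat_exp_carrier: "M \<in> carrier_mat n n \<Longrightarrow> mat_exp (t \<cdot>\<^sub>m M) \<in> carrier_mat n n"
  by (auto simp: mat_exp_def)

lemma mat_exp_zero:
  assumes M: "M \<in> carrier_mat n n"
  shows "mat_exp (0 \<cdot>\<^sub>m M) = 1\<^sub>m n"
proof (rule eq_matI)
  fix i j assume "i < dim_row (1\<^sub>m n :: real mat)" "j < dim_col (1\<^sub>m n :: real mat)"
  then show "mat_exp (0 \<cdot>\<^sub>m M) $$ (i,j) = 1\<^sub>m n $$ (i,j)"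
    using mat_exp_power_series(2)[OF M, of i j 0] M
      powser_zero[of "\<lambda>k. (M ^\<^sub>m k) $$ (i,j) / fact k"] by simp
qed (use mat_exp_carrier[OF M, of 0] in auto)

lemma mat_exp_has_derivative:
  assumes M: "M \<in> carrier_mat n n" and ij: "i < n" "j < n"
  shows "((\<lambda>t. mat_exp (t \<cdot>\<^sub>m M) $$ (i,j)) has_real_derivative
     (\<Sum>l<n. M $$ (i,l) * mat_exp (t \<cdot>\<^sub>m M) $$ (l,j))) (at t)"
proof -
  define a where "a i k = (M ^\<^sub>m k) $$ (i,j) / fact k" for i k
  have ser: "mat_exp (s \<cdot>\<^sub>m M) $$ (l,j) = (\<Sum>k. a l k * s ^ k)"
    and sm: "summable (\<lambda>k. a l k * s ^ k)" if "l < n" for l s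
    using mat_exp_power_series[OF M that ij(2)] by (auto simp: a_def)
  have "((\<lambda>t. \<Sum>k. a i k * t ^ k) has_real_derivative (\<Sum>k. diffs (a i) k * t ^ k)) (at t)"
    by (rule termdiffs_strong_converges_everywhere) (rule sm[OF ij(1)])
  \<comment> \<open>The factor k + 1 from differentiation turns the factorial of k + 1 into that of
    k, and the extra factor \<open>M\<close> is split off on the left.\<close>
  moreover have "diffs (a i) k = (\<Sum>l<n. M $$ (i,l) * a l k)" for k
  proof -
    have "(M ^\<^sub>m Suc k) $$ (i,j) = (\<Sum>l<n. M $$ (i,l) * (M ^\<^sub>m k) $$ (l,j))"
      unfolding pow_mat_Suc_left[OF M]
      using M ij pow_carrier_mat[OF M, of k] by (simp add: scalar_prod_def lessThan_atLeast0)
    then have "a i (Suc k) = (\<Sum>l<n. M $$ (i,l) * (M ^\<^sub>m k) $$ (l,j)) / fact (Suc k)"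
      unfolding a_def by simp
    moreover have "real (Suc k) * (S / fact (Suc k)) = S / fact k" for S :: real
      unfolding fact_Suc of_nat_mult of_nat_fact by (simp del: of_nat_Suc)
    ultimately have "diffs (a i) k = (\<Sum>l<n. M $$ (i,l) * (M ^\<^sub>m k) $$ (l,j)) / fact k"
      unfolding diffs_def by metis
    then show ?thesis by (simp add: a_def sum_divide_distrib)
  qed
  moreover have "(\<Sum>k. (\<Sum>l<n. M $$ (i,l) * a l k) * t ^ k) = (\<Sum>l<n. M $$ (i,l) * (\<Sum>k. a l k * t ^ k))"
  proof -
    have "(\<Sum>k. (\<Sum>l<n. M $$ (i,l) * a l k) * t ^ k) = (\<Sum>k. \<Sum>l<n. M $$ (i,l) * (a l k * t ^ k))"
      by (simp add: sum_distrib_right mult.assoc)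
    also have "\<dots> = (\<Sum>l<n. \<Sum>k. M $$ (i,l) * (a l k * t ^ k))"
      by (intro suminf_sum summable_mult sm) auto
    also have "\<dots> = (\<Sum>l<n. M $$ (i,l) * (\<Sum>k. a l k * t ^ k))"
      by (intro sum.cong refl suminf_mult sm) auto
    finally show ?thesis .
  qed
  ultimately show ?thesis using ser ij by simp
qed

lemma vec_integral_mat_exp:
  assumes M: "M \<in> carrier_mat n n" and v: "v \<in> carrier_vec n"
  shows "vec_integral n T (\<lambda>s. M *\<^sub>v (mat_exp (s \<cdot>\<^sub>m M) *\<^sub>v v)) v (\<lambda>s. mat_exp (s \<cdot>\<^sub>m M) *\<^sub>v v)"
proof (rule vec_integral_FTC)
  note E = mat_exp_carrier[OF M]
  show "mat_exp (s \<cdot>\<^sub>m M) *\<^sub>v v \<in> carrier_vec n" "M *\<^sub>v (mat_exp (s \<cdot>\<^sub>m M) *\<^sub>v v) \<in> carrier_vec n" for s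
    using M E[of s] v by auto
  show "mat_exp (0 \<cdot>\<^sub>m M) *\<^sub>v v = v" using mat_exp_zero[OF M] v by simp
  fix i s assume i: "i < n"
  have Ev: "(mat_exp (s \<cdot>\<^sub>m M) *\<^sub>v v) $ l = (\<Sum>j<n. mat_exp (s \<cdot>\<^sub>m M) $$ (l,j) * v $ j)" if "l < n" for l s
    using E[of s] v that by (simp add: scalar_prod_def lessThan_atLeast0)
  have "((\<lambda>s. \<Sum>j<n. mat_exp (s \<cdot>\<^sub>m M) $$ (i,j) * v $ j) has_real_derivative
      (\<Sum>j<n. (\<Sum>l<n. M $$ (i,l) * mat_exp (s \<cdot>\<^sub>m M) $$ (l,j)) * v $ j)) (at s)"
    by (intro DERIV_sum DERIV_cmult_right mat_exp_has_derivative[OF M i]) auto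
  moreover have "(\<Sum>j<n. (\<Sum>l<n. M $$ (i,l) * mat_exp (s \<cdot>\<^sub>m M) $$ (l,j)) * v $ j) =
      (M *\<^sub>v (mat_exp (s \<cdot>\<^sub>m M) *\<^sub>v v)) $ i"
  proof -
    have "(M *\<^sub>v (mat_exp (s \<cdot>\<^sub>m M) *\<^sub>v v)) $ i = (\<Sum>l<n. M $$ (i,l) * (mat_exp (s \<cdot>\<^sub>m M) *\<^sub>v v) $ l)"
      using E[of s] M v i by (simp add: scalar_prod_def lessThan_atLeast0)
    also have "\<dots> = (\<Sum>l<n. \<Sum>j<n. M $$ (i,l) * mat_exp (s \<cdot>\<^sub>m M) $$ (l,j) * v $ j)"
      by (intro sum.cong refl) (simp add: Ev sum_distrib_left mult.assoc)
    also have "\<dots> = (\<Sum>j<n. \<Sum>l<n. M $$ (i,l) * mat_exp (s \<cdot>\<^sub>m M) $$ (l,j) * v $ j)"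
      by (rule sum.swap)
    finally show ?thesis by (simp add: sum_distrib_right)
  qed
  ultimately show "((\<lambda>s. (mat_exp (s \<cdot>\<^sub>m M) *\<^sub>v v) $ i) has_real_derivative
      (M *\<^sub>v (mat_exp (s \<cdot>\<^sub>m M) *\<^sub>v v)) $ i) (at s)"
    using Ev[OF i] by simp
qed (rule v)

subsection \<open>Symmetric intertwiners of a companion matrix and its transpose\<close>

lemma comp_mat_carrier[simp]: "comp_mat n c \<in> carrier_mat n n" by (simp add: comp_mat_def)

lemma filt_B_carrier[simp]: "filt_B n \<in> carrier_vec n" by (simp add: filt_B_def)

lemma dim_comp_mat[simp]: "dim_row (comp_mat n c) = n" "dim_col (comp_mat n c) = n"
  by (simp_all add: comp_mat_def)

lemma dim_filt_B[simp]: "dim_vec (filt_B n) = n" by (simp add: filt_B_def)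

text \<open>For the first unit vector the intertwiner is the Hankel matrix of the coefficients;
  multiplication by the transposed companion matrix preserves all requirements and shifts the
  unit vectors.\<close>

lemma symmetric_intertwiner:
  assumes n: "n \<ge> 1" and v: "v \<in> carrier_vec n"
  shows "\<exists>S \<in> carrier_mat n n. transpose_mat S = S \<and>
    S * comp_mat n c = transpose_mat (comp_mat n c) * S \<and> S *\<^sub>v filt_B n = v"
proof -
  define C where "C = comp_mat n c"
  have C: "C \<in> carrier_mat n n" and Ct: "transpose_mat C \<in> carrier_mat n n" by (auto simp: C_def)
  \<comment> \<open>The vectors attained by some intertwiner form a linear subspace invariant under
    the transposed companion matrix; it suffices to find one cyclic vector in it.\<close>
  define G where "G v \<longleftrightarrow> (\<exists>S \<in> carrier_mat n n. transpose_mat S = S \<and>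
    S * C = transpose_mat C * S \<and> S *\<^sub>v filt_B n = v)" for v
  have G_add: "G (v + w)" if "G v" "G w" for v w
  proof -
    from that obtain S R where S: "S \<in> carrier_mat n n" "transpose_mat S = S" "S * C = transpose_mat C * S" "S *\<^sub>v filt_B n = v"
      and R: "R \<in> carrier_mat n n" "transpose_mat R = R" "R * C = transpose_mat C * R" "R *\<^sub>v filt_B n = w"
      unfolding G_def by auto
    have "transpose_mat (S + R) = S + R"
      using transpose_add[OF S(1) R(1)] S(2) R(2) by simp
    moreover have "(S + R) * C = transpose_mat C * (S + R)"
      using add_mult_distrib_mat[OF S(1) R(1) C] mult_add_distrib_mat[OF Ct S(1) R(1)] S(3) R(3) by simp
    moreover have "(S + R) *\<^sub>v filt_B n = v + w"
      using add_mult_distrib_mat_vec[OF S(1) R(1) filt_B_carrier] S(4) R(4) by simp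
    ultimately show ?thesis unfolding G_def using S(1) R(1) by (intro bexI[of _ "S + R"]) auto
  qed
  have G_smult: "G (k \<cdot>\<^sub>v v)" if "G v" for k v
  proof -
    from that obtain S where S: "S \<in> carrier_mat n n" "transpose_mat S = S" "S * C = transpose_mat C * S" "S *\<^sub>v filt_B n = v"
      unfolding G_def by auto
    have "transpose_mat (k \<cdot>\<^sub>m S) = k \<cdot>\<^sub>m S"
    proof (rule eq_matI)
      fix i j assume "i < dim_row (k \<cdot>\<^sub>m S)" "j < dim_col (k \<cdot>\<^sub>m S)"
      then show "transpose_mat (k \<cdot>\<^sub>m S) $$ (i,j) = (k \<cdot>\<^sub>m S) $$ (i,j)"
        using S(1) arg_cong[OF S(2), of "\<lambda>A. A $$ (i,j)"] by simp
    qed (use S(1) in auto)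
    moreover have "k \<cdot>\<^sub>m S *\<^sub>v filt_B n = k \<cdot>\<^sub>v v"
    proof (rule eq_vecI)
      fix i assume "i < dim_vec (k \<cdot>\<^sub>v v)"
      then have i: "i < n" using S(1,4) by auto
      have "row S i \<in> carrier_vec n" using S(1) by auto
      from smult_scalar_prod_distrib[OF this filt_B_carrier, of k] i
      show "(k \<cdot>\<^sub>m S *\<^sub>v filt_B n) $ i = (k \<cdot>\<^sub>v v) $ i"
        unfolding S(4)[symmetric] using S(1) by simp
    qed (use S(1,4) in auto)
    ultimately show ?thesis unfolding G_def
      by (intro bexI[of _ "k \<cdot>\<^sub>m S"])
        (use S C Ct in \<open>auto simp: mult_smult_assoc_mat[of _ n n _ n] mult_smult_distrib[of _ n n _ n]\<close>)
  qed
  have G_mult: "G (transpose_mat C *\<^sub>v v)" if "G v" for v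
  proof -
    from that obtain S where S: "S \<in> carrier_mat n n" "transpose_mat S = S" "S * C = transpose_mat C * S" "S *\<^sub>v filt_B n = v"
      unfolding G_def by auto
    \<comment> \<open>The transpose is \<open>S * C\<close> by symmetry of \<open>S\<close>, and the
      intertwining relation turns this back into \<open>transpose_mat C * S\<close>.\<close>
    have "transpose_mat (transpose_mat C * S) = transpose_mat C * S"
      using S C by (simp add: transpose_mult[of _ n n _ n])
    moreover have "transpose_mat C * S * C = transpose_mat C * (transpose_mat C * S)"
      using S C Ct by (simp add: assoc_mult_mat[of _ n n _ n _ n])
    moreover have "transpose_mat C * S *\<^sub>v filt_B n = transpose_mat C *\<^sub>v v"
      using S Ct by (simp add: assoc_mult_mat_vec[of _ n n _ n])
    ultimately show ?thesis unfolding G_def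
      by (intro bexI[of _ "transpose_mat C * S"]) (use S Ct in auto)
  qed
  obtain p where p: "n = Suc p" using n by (cases n) auto
  have G0: "G (unit_vec n 0)"
  proof -
    \<comment> \<open>For k up to p, \<open>f k\<close> is the coefficient of degree k + 1 in the
      characteristic polynomial of \<open>C\<close>. The Hankel matrix of \<open>f\<close> is the
      classical symmetrizer of a companion matrix, with ones on the antidiagonal and zeros below it,
      so its last column is the first unit vector.\<close>
    define f where "f k = (if k = p then 1 else if k < p then c (p - k) else 0)" for k
    define S where "S = mat n n (\<lambda>(i,j). f (i + j))"
    have S: "S \<in> carrier_mat n n" by (auto simp: S_def)
    have sym: "transpose_mat S = S" by (rule eq_matI) (auto simp: S_def add.commute)
    \<comment> \<open>The right side is symmetric in i and j. In row 0 and column j > 0 the shifted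
      entry f (j - 1) equals c (n - j) and cancels against the last row of \<open>C\<close>.\<close>
    have SC: "(S * C) $$ (i,j) = (if i = 0 \<and> j = 0 then - c n else if i = 0 \<or> j = 0 then 0 else f (i + j - 1))"
      if ij: "i < n" "j < n" for i j
    proof -
      have "(S * C) $$ (i,j) = (\<Sum>k<n. f (i + k) * C $$ (k,j))"
        using ij S C by (simp add: scalar_prod_def lessThan_atLeast0 S_def)
      also have "\<dots> = (\<Sum>k<p. f (i + k) * C $$ (k,j)) + f (i + p) * C $$ (p,j)"
        unfolding p by simp
      also have "(\<Sum>k<p. f (i + k) * C $$ (k,j)) = (\<Sum>k<p. if k = j - 1 then (if j = 0 then 0 else f (i + k)) else 0)"
        using ij by (intro sum.cong refl) (auto simp: C_def comp_mat_def p)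
      also have "\<dots> = (if j = 0 then 0 else f (i + j - 1))"
        using ij p by (auto simp: sum.delta')
      also have "f (i + p) * C $$ (p,j) = (if i = 0 then - c (n - j) else 0)"
        using ij by (auto simp: f_def C_def comp_mat_def p)
      finally show ?thesis using ij p by (auto simp: f_def)
    qed
    have "transpose_mat C * S = transpose_mat (S * C)"
      using S C sym by (simp add: transpose_mult[of _ n n _ n])
    also have "\<dots> = S * C"
    proof (rule eq_matI)
      fix i j assume "i < dim_row (S * C)" "j < dim_col (S * C)"
      then have ij: "i < n" "j < n" using S C by auto
      then show "transpose_mat (S * C) $$ (i,j) = (S * C) $$ (i,j)"
        using SC[of i j] SC[of j i] S C by (auto simp: add.commute)
    qed (use S C in auto)
    finally have "S * C = transpose_mat C * S" by simp
    moreover have "S *\<^sub>v filt_B n = unit_vec n 0"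
    proof (rule eq_vecI)
      fix i assume "i < dim_vec (unit_vec n 0 :: real vec)"
      then have i: "i < n" by simp
      then have "(S *\<^sub>v filt_B n) $ i = f (i + p)"
        using S p by (simp add: filt_B_def S_def)
      then show "(S *\<^sub>v filt_B n) $ i = unit_vec n 0 $ i" using i by (auto simp: f_def)
    qed (use S in auto)
    ultimately show ?thesis unfolding G_def using S sym by blast
  qed
  have Gk: "G (unit_vec n k)" if "k < n" for k
    using that
  proof (induction k)
    case (Suc k)
    have "transpose_mat C *\<^sub>v unit_vec n k = unit_vec n (Suc k)"
      by (rule eq_vecI) (use Suc.prems C in \<open>auto simp: C_def comp_mat_def\<close>)
    then show ?case using G_mult[OF Suc.IH] Suc.prems by simp
  qed (rule G0)
  have "G (vec n (\<lambda>i. if i < m then v $ i else 0))" if "m \<le> n" for m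
    using that
  proof (induction m)
    case 0
    have "vec n (\<lambda>i. if i < 0 then v $ i else 0) = 0 \<cdot>\<^sub>v unit_vec n 0" by (rule eq_vecI) auto
    then show ?case using G_smult[OF G0, of 0] by simp
  next
    case (Suc m)
    have "vec n (\<lambda>i. if i < Suc m then v $ i else 0) = vec n (\<lambda>i. if i < m then v $ i else 0) + v $ m \<cdot>\<^sub>v unit_vec n m"
      by (rule eq_vecI) (use Suc.prems in \<open>auto simp: less_Suc_eq\<close>)
    then show ?case using G_add[OF _ G_smult[OF Gk]] Suc by simp
  qed
  moreover have "vec n (\<lambda>i. if i < n then v $ i else 0) = v"
    using v by (intro eq_vecI) auto
  ultimately have "G v" by (metis order_refl)
  then show ?thesis unfolding G_def C_def .
qed

subsection \<open>The filtered plant\<close>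

text \<open>Output injection: the plant matrix and the transposed filter matrix differ in the last
  column only, and that column multiplies the output.\<close>

lemma plant_A_mult_vec:
  assumes n: "n \<ge> 1" and v: "v \<in> carrier_vec n"
  shows "plant_A n a *\<^sub>v v =
    transpose_mat (comp_mat n c) *\<^sub>v v + v $ (n - 1) \<cdot>\<^sub>v vec n (\<lambda>i. c (n - i) - a (n - i))"
proof (rule eq_vecI)
  fix i assume "i < dim_vec (transpose_mat (comp_mat n c) *\<^sub>v v + v $ (n - 1) \<cdot>\<^sub>v vec n (\<lambda>i. c (n - i) - a (n - i)))"
  then have i: "i < n" by simp
  have "(plant_A n a *\<^sub>v v) $ i = (\<Sum>j<n. plant_A n a $$ (i,j) * v $ j)"
    using i v by (simp add: plant_A_def scalar_prod_def lessThan_atLeast0)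
  also have "\<dots> = (\<Sum>j<n. comp_mat n c $$ (j,i) * v $ j + (if j = n - 1 then v $ j * (c (n - i) - a (n - i)) else 0))"
    using i by (intro sum.cong refl) (auto simp: plant_A_def comp_mat_def algebra_simps)
  also have "\<dots> = (\<Sum>j<n. comp_mat n c $$ (j,i) * v $ j) + v $ (n - 1) * (c (n - i) - a (n - i))"
    using n by (simp add: sum.distrib)
  also have "(\<Sum>j<n. comp_mat n c $$ (j,i) * v $ j) = (transpose_mat (comp_mat n c) *\<^sub>v v) $ i"
    using i v by (simp add: comp_mat_def scalar_prod_def lessThan_atLeast0)
  finally show "(plant_A n a *\<^sub>v v) $ i =
      (transpose_mat (comp_mat n c) *\<^sub>v v + v $ (n - 1) \<cdot>\<^sub>v vec n (\<lambda>i. c (n - i) - a (n - i))) $ i"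
    using i by simp
qed (simp add: plant_A_def)

text \<open>\<open>S\<close> carries a filter with matrix \<open>C\<close> and input vector
  \<open>e\<close> to one with the transposed matrix and input vector \<open>S *\<^sub>v e\<close>,
  the form in which the plant state evolves.\<close>

lemma intertwined_filter:
  assumes S: "S \<in> carrier_mat n n" and C: "C \<in> carrier_mat n n" and SC: "S * C = transpose_mat C * S"
    and e: "e \<in> carrier_vec n" and Se: "S *\<^sub>v e = v"
    and z: "vec_integral n T (\<lambda>s. C *\<^sub>v z s + w s \<cdot>\<^sub>v e) (0\<^sub>v n) z"
  shows "vec_integral n T (\<lambda>s. transpose_mat C *\<^sub>v (S *\<^sub>v z s) + w s \<cdot>\<^sub>v v) (0\<^sub>v n) (\<lambda>s. S *\<^sub>v z s)"
proof (rule vec_integral_cong[OF vec_integral_mult_mat[OF z S]])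
  show "S *\<^sub>v 0\<^sub>v n = 0\<^sub>v n" using S by (intro eq_vecI) auto
  fix s assume "s \<in> {0..T}"
  then have zs: "z s \<in> carrier_vec n" using z by (auto simp: vec_integral_def)
  have "S *\<^sub>v (C *\<^sub>v z s + w s \<cdot>\<^sub>v e) = S *\<^sub>v (C *\<^sub>v z s) + w s \<cdot>\<^sub>v (S *\<^sub>v e)"
    using S C e zs by (simp add: mult_add_distrib_mat_vec[of _ n n] mult_mat_vec[of _ n n])
  moreover have "S *\<^sub>v (C *\<^sub>v z s) = transpose_mat C *\<^sub>v (S *\<^sub>v z s)"
    using SC S C zs by (metis assoc_mult_mat_vec transpose_carrier_mat)
  ultimately show "S *\<^sub>v (C *\<^sub>v z s + w s \<cdot>\<^sub>v e) = transpose_mat C *\<^sub>v (S *\<^sub>v z s) + w s \<cdot>\<^sub>v v"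
    using Se by simp
qed auto

lemma symmetric_mult_last:
  assumes S: "S \<in> carrier_mat n n" and sym: "transpose_mat S = S" and Se: "S *\<^sub>v filt_B n = v"
    and n: "n \<ge> 1" and z: "z \<in> carrier_vec n"
  shows "(S *\<^sub>v z) $ (n - 1) = v \<bullet> z"
proof -
  have "(S *\<^sub>v z) $ (n - 1) = filt_B n \<bullet> (S *\<^sub>v z)"
    using n S z unfolding filt_B_def by (subst scalar_prod_left_unit[of _ n]) auto
  also have "\<dots> = v \<bullet> z"
    using transpose_vec_mult_scalar[OF S z, of "filt_B n"] sym Se by simp
  finally show ?thesis .
qed

text \<open>With symmetric intertwiners \<open>S\<close>, \<open>R\<close> of the companion matrix and its transpose, the
  state is \<open>S \<zeta> + R \<mu>\<close> plus a free response, since both sides solve the same equation; symmetry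
  turns the last row of \<open>S\<close> into \<open>S *\<^sub>v filt_B n\<close>.\<close>

lemma output_from_filters:
  assumes n: "n \<ge> 1" and x0: "x0 \<in> carrier_vec n"
    and x: "lin_ode_sol (plant_A n a) (\<lambda>s. u s \<cdot>\<^sub>v plant_B n b) x0 T x"
    and zeta: "lin_ode_sol (comp_mat n c) (\<lambda>s. u s \<cdot>\<^sub>v filt_B n) (0\<^sub>v n) T \<zeta>"
    and mu: "lin_ode_sol (comp_mat n c) (\<lambda>s. (x s $ (n - 1)) \<cdot>\<^sub>v filt_B n) (0\<^sub>v n) T \<mu>"
    and t: "t \<in> {0..T}"
  shows "x t $ (n - 1) = plant_B n b \<bullet> \<zeta> t + vec n (\<lambda>i. c (n - i) - a (n - i)) \<bullet> \<mu> t
    + (mat_exp (t \<cdot>\<^sub>m transpose_mat (comp_mat n c)) *\<^sub>v x0) $ (n - 1)"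
proof -
  define C where "C = comp_mat n c"
  define M where "M = transpose_mat C"
  define d where "d = vec n (\<lambda>i. c (n - i) - a (n - i))"
  define h where "h s = mat_exp (s \<cdot>\<^sub>m M) *\<^sub>v x0" for s
  have C: "C \<in> carrier_mat n n" and M: "M \<in> carrier_mat n n" by (auto simp: C_def M_def)
  have d: "d \<in> carrier_vec n" and B: "plant_B n b \<in> carrier_vec n" by (auto simp: d_def plant_B_def)
  have plant_carrier: "plant_A n a \<in> carrier_mat n n" by (simp add: plant_A_def)
  \<comment> \<open>The output is treated as a second known input. The state equation then has
    matrix \<open>M\<close>, with \<open>plant_B n b\<close> as input vector for u and
    \<open>d\<close> for y; \<open>S\<close> and \<open>R\<close> below are chosen for these two
    vectors.\<close>
  define g where "g s = x s $ (n - 1) \<cdot>\<^sub>v d + u s \<cdot>\<^sub>v plant_B n b" for s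
  have g: "g s \<in> carrier_vec n" for s using d B by (auto simp: g_def)
  have ix: "vec_integral n T (\<lambda>s. plant_A n a *\<^sub>v x s + u s \<cdot>\<^sub>v plant_B n b) x0 x"
    by (rule vec_integral_of_lin_ode_sol[OF x plant_carrier]) (use B in auto)
  have ix': "vec_integral n T (\<lambda>s. M *\<^sub>v x s + g s) x0 x"
  proof (rule vec_integral_cong[OF ix])
    fix s assume "s \<in> {0..T}"
    then have xs: "x s \<in> carrier_vec n" using ix by (auto simp: vec_integral_def)
    show "plant_A n a *\<^sub>v x s + u s \<cdot>\<^sub>v plant_B n b = M *\<^sub>v x s + g s"
      unfolding plant_A_mult_vec[OF n xs, of a c, folded C_def d_def, folded M_def] g_def
      by (rule assoc_add_vec[of _ n]) (use M xs d B in auto)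
  qed auto
  have iz: "vec_integral n T (\<lambda>s. C *\<^sub>v \<zeta> s + u s \<cdot>\<^sub>v filt_B n) (0\<^sub>v n) \<zeta>"
    unfolding C_def by (rule vec_integral_of_lin_ode_sol[OF zeta]) auto
  have im: "vec_integral n T (\<lambda>s. C *\<^sub>v \<mu> s + x s $ (n - 1) \<cdot>\<^sub>v filt_B n) (0\<^sub>v n) \<mu>"
    unfolding C_def by (rule vec_integral_of_lin_ode_sol[OF mu]) auto
  obtain S where S: "S \<in> carrier_mat n n" "transpose_mat S = S" "S * C = transpose_mat C * S"
      "S *\<^sub>v filt_B n = plant_B n b"
    using symmetric_intertwiner[OF n B, of c] unfolding C_def by auto
  obtain R where R: "R \<in> carrier_mat n n" "transpose_mat R = R" "R * C = transpose_mat C * R"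
      "R *\<^sub>v filt_B n = d"
    using symmetric_intertwiner[OF n d, of c] unfolding C_def by auto
  note iS = intertwined_filter[OF S(1) C S(3) filt_B_carrier S(4) iz, folded M_def]
  note iR = intertwined_filter[OF R(1) C R(3) filt_B_carrier R(4) im, folded M_def]
  note ih = vec_integral_mat_exp[OF M x0, of T, folded h_def]
  have "vec_integral n T (\<lambda>s. M *\<^sub>v (S *\<^sub>v \<zeta> s + R *\<^sub>v \<mu> s + h s) + g s) x0 (\<lambda>s. S *\<^sub>v \<zeta> s + R *\<^sub>v \<mu> s + h s)"
  proof (rule vec_integral_cong[OF vec_integral_add[OF vec_integral_add[OF iS iR] ih]])
    show "0\<^sub>v n + 0\<^sub>v n + x0 = x0" using x0 by simp
    fix s assume "s \<in> {0..T}"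
    then have c: "S *\<^sub>v \<zeta> s \<in> carrier_vec n" "R *\<^sub>v \<mu> s \<in> carrier_vec n" "h s \<in> carrier_vec n"
      using iS iR ih by (auto simp: vec_integral_def)
    have "M *\<^sub>v (S *\<^sub>v \<zeta> s + R *\<^sub>v \<mu> s + h s) = M *\<^sub>v (S *\<^sub>v \<zeta> s) + M *\<^sub>v (R *\<^sub>v \<mu> s) + M *\<^sub>v h s"
      using c M by (metis mult_add_distrib_mat_vec add_carrier_vec)
    then show "M *\<^sub>v (S *\<^sub>v \<zeta> s) + u s \<cdot>\<^sub>v plant_B n b + (M *\<^sub>v (R *\<^sub>v \<mu> s) + x s $ (n - 1) \<cdot>\<^sub>v d) + M *\<^sub>v h s =
        M *\<^sub>v (S *\<^sub>v \<zeta> s + R *\<^sub>v \<mu> s + h s) + g s"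
      using M d B by (intro eq_vecI) (auto simp: g_def)
  qed auto
  from linear_integral_equation_unique[OF ix' this M g t]
  have xt: "x t = S *\<^sub>v \<zeta> t + R *\<^sub>v \<mu> t + h t" .
  have zt: "\<zeta> t \<in> carrier_vec n" "\<mu> t \<in> carrier_vec n" "h t \<in> carrier_vec n"
    using iz im ih t by (auto simp: vec_integral_def)
  have "x t $ (n - 1) = (S *\<^sub>v \<zeta> t) $ (n - 1) + (R *\<^sub>v \<mu> t) $ (n - 1) + h t $ (n - 1)"
    unfolding xt using zt S R n by simp
  then show ?thesis
    unfolding symmetric_mult_last[OF S(1,2,4) n zt(1)] symmetric_mult_last[OF R(1,2,4) n zt(2)]
    by (simp add: d_def h_def M_def C_def)
qed

text \<open>The column of \<^const>\<open>B_f\<close> and the nonzero column of \<^const>\<open>G_f\<close>.\<close>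

definition in_col :: "nat \<Rightarrow> real vec" where "in_col n = filt_B n @\<^sub>v 0\<^sub>v n"

definition out_col :: "nat \<Rightarrow> real vec" where "out_col n = 0\<^sub>v n @\<^sub>v filt_B n"

lemma in_out_col_carrier[simp]: "in_col n \<in> carrier_vec (2 * n)" "out_col n \<in> carrier_vec (2 * n)"
  using append_carrier_vec[of "filt_B n" n "0\<^sub>v n" n] append_carrier_vec[of "0\<^sub>v n" n "filt_B n" n]
  by (auto simp: in_col_def out_col_def mult_2)

lemma dim_in_out_col[simp]: "dim_vec (in_col n) = 2 * n" "dim_vec (out_col n) = 2 * n"
  by (simp_all add: in_col_def out_col_def)

section \<open>Integral equations of the filtered signals\<close>

lemma A_f_carrier: "A_f n a b c \<in> carrier_mat (2 * n) (2 * n)"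
  by (auto simp: A_f_def L_b_def comp_mat_def mult_2)

lemma L_b_carrier[simp]: "L_b n b \<in> carrier_mat n n" by (simp add: L_b_def)

lemma L_b_mult_vec:
  assumes "v \<in> carrier_vec n"
  shows "L_b n b *\<^sub>v v = (plant_B n b \<bullet> v) \<cdot>\<^sub>v filt_B n"
  by (rule eq_vecI) (use assms in \<open>auto simp: L_b_def filt_B_def plant_B_def scalar_prod_def\<close>)

lemma comp_mat_mult_vec_diff:
  assumes v: "v \<in> carrier_vec n"
  shows "comp_mat n a *\<^sub>v v = comp_mat n c *\<^sub>v v + (vec n (\<lambda>i. c (n - i) - a (n - i)) \<bullet> v) \<cdot>\<^sub>v filt_B n"
proof (rule eq_vecI)
  fix i assume "i < dim_vec (comp_mat n c *\<^sub>v v + (vec n (\<lambda>i. c (n - i) - a (n - i)) \<bullet> v) \<cdot>\<^sub>v filt_B n)"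
  then have i: "i < n" by (simp add: filt_B_def)
  show "(comp_mat n a *\<^sub>v v) $ i = (comp_mat n c *\<^sub>v v + (vec n (\<lambda>i. c (n - i) - a (n - i)) \<bullet> v) \<cdot>\<^sub>v filt_B n) $ i"
    using i v by (auto simp: comp_mat_def filt_B_def scalar_prod_def sum.distrib[symmetric] algebra_simps
        intro!: sum.cong)
qed (simp add: comp_mat_def filt_B_def)

lemma G_f_mult_vec:
  assumes n: "n \<ge> 1" and v: "v \<in> carrier_vec n"
  shows "G_f n *\<^sub>v v = v $ (n - 1) \<cdot>\<^sub>v out_col n"
proof (rule eq_vecI)
  fix i assume "i < dim_vec (v $ (n - 1) \<cdot>\<^sub>v out_col n)"
  then have i: "i < 2 * n" by (simp add: out_col_def filt_B_def)
  have "(G_f n *\<^sub>v v) $ i = (\<Sum>j<n. if j = n - 1 then (if i = 2 * n - 1 then v $ j else 0) else 0)"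
  proof -
    have "(G_f n *\<^sub>v v) $ i = (\<Sum>j<n. G_f n $$ (i,j) * v $ j)"
      using i v by (simp add: G_f_def scalar_prod_def lessThan_atLeast0)
    also have "\<dots> = (\<Sum>j<n. if j = n - 1 then (if i = 2 * n - 1 then v $ j else 0) else 0)"
      using i by (intro sum.cong refl) (auto simp: G_f_def)
    finally show ?thesis .
  qed
  also have "\<dots> = (if i = 2 * n - 1 then v $ (n - 1) else 0)" using n by simp
  also have "\<dots> = (v $ (n - 1) \<cdot>\<^sub>v out_col n) $ i"
    using i n by (auto simp: out_col_def filt_B_def)
  finally show "(G_f n *\<^sub>v v) $ i = (v $ (n - 1) \<cdot>\<^sub>v out_col n) $ i" .
qed (simp add: G_f_def out_col_def filt_B_def)

text \<open>Inserting the output formula into the second filter closes the loop: the weights of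
  \<zeta> form \<open>L_b\<close>, those of \<mu> turn the last row of the filter matrix into that
  of the plant polynomial, and the free response is left as a disturbance of the last
  coordinate.\<close>

lemma chi_integral:
  assumes n: "n \<ge> 1" and x0: "x0 \<in> carrier_vec n"
    and x: "lin_ode_sol (plant_A n a) (\<lambda>s. u s \<cdot>\<^sub>v plant_B n b) x0 T x"
    and zeta: "lin_ode_sol (comp_mat n c) (\<lambda>s. u s \<cdot>\<^sub>v filt_B n) (0\<^sub>v n) T \<zeta>"
    and mu: "lin_ode_sol (comp_mat n c) (\<lambda>s. (x s $ (n - 1)) \<cdot>\<^sub>v filt_B n) (0\<^sub>v n) T \<mu>"
  defines "h \<equiv> \<lambda>s. mat_exp (s \<cdot>\<^sub>m transpose_mat (comp_mat n c)) *\<^sub>v x0"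
  shows "vec_integral (2 * n) T (\<lambda>s. A_f n a b c *\<^sub>v (\<zeta> s @\<^sub>v \<mu> s) + u s \<cdot>\<^sub>v in_col n + h s $ (n - 1) \<cdot>\<^sub>v out_col n)
    (0\<^sub>v (2 * n)) (\<lambda>s. \<zeta> s @\<^sub>v \<mu> s)"
proof -
  have iz: "vec_integral n T (\<lambda>s. comp_mat n c *\<^sub>v \<zeta> s + u s \<cdot>\<^sub>v filt_B n) (0\<^sub>v n) \<zeta>"
    by (rule vec_integral_of_lin_ode_sol[OF zeta]) auto
  have im: "vec_integral n T (\<lambda>s. comp_mat n c *\<^sub>v \<mu> s + x s $ (n - 1) \<cdot>\<^sub>v filt_B n) (0\<^sub>v n) \<mu>"
    by (rule vec_integral_of_lin_ode_sol[OF mu]) auto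
  show ?thesis
    unfolding mult_2
  proof (rule vec_integral_cong[OF vec_integral_append[OF iz im]])
    show "0\<^sub>v n @\<^sub>v 0\<^sub>v n = (0\<^sub>v (n + n) :: real vec)" by (rule eq_vecI) auto
    fix s assume s: "s \<in> {0..T}"
    have c: "\<zeta> s \<in> carrier_vec n" "\<mu> s \<in> carrier_vec n"
      using iz im s by (auto simp: vec_integral_def)
    have "A_f n a b c *\<^sub>v (\<zeta> s @\<^sub>v \<mu> s) =
        (comp_mat n c *\<^sub>v \<zeta> s + 0\<^sub>m n n *\<^sub>v \<mu> s) @\<^sub>v (L_b n b *\<^sub>v \<zeta> s + comp_mat n a *\<^sub>v \<mu> s)"
      unfolding A_f_def by (rule four_block_mat_mult_vec[where ?nr2.0 = n]) (use c in auto)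
    also have "comp_mat n c *\<^sub>v \<zeta> s + 0\<^sub>m n n *\<^sub>v \<mu> s = comp_mat n c *\<^sub>v \<zeta> s"
      using c by (intro eq_vecI) auto
    finally have Af: "A_f n a b c *\<^sub>v (\<zeta> s @\<^sub>v \<mu> s) =
      comp_mat n c *\<^sub>v \<zeta> s @\<^sub>v (L_b n b *\<^sub>v \<zeta> s + comp_mat n a *\<^sub>v \<mu> s)" .
    note y = output_from_filters[OF n x0 x zeta mu s]
    have dims: "dim_vec (filt_B n) = n" "dim_row (comp_mat n c) = n"
      by (auto simp: filt_B_def comp_mat_def)
    show "(comp_mat n c *\<^sub>v \<zeta> s + u s \<cdot>\<^sub>v filt_B n) @\<^sub>v (comp_mat n c *\<^sub>v \<mu> s + x s $ (n - 1) \<cdot>\<^sub>v filt_B n) =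
        A_f n a b c *\<^sub>v (\<zeta> s @\<^sub>v \<mu> s) + u s \<cdot>\<^sub>v in_col n + h s $ (n - 1) \<cdot>\<^sub>v out_col n"
      unfolding Af L_b_mult_vec[OF c(1)] comp_mat_mult_vec_diff[OF c(2), of a c] y h_def in_col_def out_col_def
      by (rule eq_vecI) (auto simp: dims algebra_simps)
  qed auto
qed

text \<open>The error is the disturbance of \<chi> filtered by 1 / (s + \<beta>).
  \<open>Gamma_star\<close> is the solution of \<Gamma> \<open>Mb\<close> = \<open>G_f n\<close>,
  and \<open>Mb\<close> is invertible because - \<beta> is no eigenvalue. Subtracting the scalar
  exponential makes the start zero.\<close>

lemma eps_integral:
  assumes n: "n \<ge> 1" and x0: "x0 \<in> carrier_vec n" and ne: "\<not> eigenvalue (comp_mat n c) (- \<beta>)"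
  defines "h \<equiv> \<lambda>s. mat_exp (s \<cdot>\<^sub>m transpose_mat (comp_mat n c)) *\<^sub>v x0"
  shows "vec_integral (2 * n) T (\<lambda>s. (- \<beta>) \<cdot>\<^sub>v eps_fun n c \<beta> x0 s + h s $ (n - 1) \<cdot>\<^sub>v out_col n)
    (0\<^sub>v (2 * n)) (eps_fun n c \<beta> x0)"
proof -
  define M where "M = transpose_mat (comp_mat n c)"
  have M: "M \<in> carrier_mat n n" by (simp add: M_def)
  define Mb where "Mb = M + \<beta> \<cdot>\<^sub>m 1\<^sub>m n"
  have Mb: "Mb \<in> carrier_mat n n" using M by (simp add: Mb_def)
  have "\<not> eigenvalue M (- \<beta>)" unfolding M_def using ne eigenvalue_transpose[of "comp_mat n c" n] by simp
  then have "det (char_matrix M (- \<beta>)) \<noteq> 0" using eigenvalue_det[OF M] by simp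
  then have det: "det Mb \<noteq> 0" using M unfolding char_matrix_def Mb_def by simp
  note inv = mat_inv_inverse[OF Mb det]
  define \<Gamma> where "\<Gamma> = Gamma_star n c \<beta>"
  have G: "G_f n \<in> carrier_mat (2 * n) n" by (simp add: G_f_def)
  have \<Gamma>_eq: "\<Gamma> = G_f n * mat_inv Mb" unfolding \<Gamma>_def Gamma_star_def Mb_def M_def ..
  have \<Gamma>: "\<Gamma> \<in> carrier_mat (2 * n) n" unfolding \<Gamma>_eq using G inv(3) by auto
  have \<Gamma>M: "\<Gamma> * Mb = G_f n"
    unfolding \<Gamma>_eq using assoc_mult_mat[OF G inv(3) Mb] inv(2) G by simp
  have ih: "vec_integral n T (\<lambda>s. M *\<^sub>v h s) x0 h"
    unfolding h_def M_def[symmetric] by (rule vec_integral_mat_exp[OF M x0])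
  have hc: "h s \<in> carrier_vec n" for s
    unfolding h_def M_def[symmetric] using mat_exp_carrier[OF M, of s] x0 by auto
  have ie: "vec_integral n T (\<lambda>s. (\<beta> * exp (- \<beta> * s)) \<cdot>\<^sub>v x0) ((-1) \<cdot>\<^sub>v x0) (\<lambda>s. (- exp (- \<beta> * s)) \<cdot>\<^sub>v x0)"
  proof (rule vec_integral_FTC)
    fix i s assume "i < n"
    then show "((\<lambda>s. (- exp (- \<beta> * s) \<cdot>\<^sub>v x0) $ i) has_real_derivative (\<beta> * exp (- \<beta> * s) \<cdot>\<^sub>v x0) $ i) (at s)"
      using x0 by (auto intro!: derivative_eq_intros)
  qed (use x0 in auto)
  have eps: "eps_fun n c \<beta> x0 s = \<Gamma> *\<^sub>v (h s + (- exp (- \<beta> * s)) \<cdot>\<^sub>v x0)" for s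
  proof -
    have "(mat_exp (s \<cdot>\<^sub>m M) - exp (- \<beta> * s) \<cdot>\<^sub>m 1\<^sub>m n) *\<^sub>v x0 = h s + (- exp (- \<beta> * s)) \<cdot>\<^sub>v x0"
    proof -
      have "(exp (- \<beta> * s) \<cdot>\<^sub>m 1\<^sub>m n) *\<^sub>v x0 = exp (- \<beta> * s) \<cdot>\<^sub>v x0"
        using x0 by (intro eq_vecI) auto
      moreover have "(mat_exp (s \<cdot>\<^sub>m M) - exp (- \<beta> * s) \<cdot>\<^sub>m 1\<^sub>m n) *\<^sub>v x0 =
          mat_exp (s \<cdot>\<^sub>m M) *\<^sub>v x0 - (exp (- \<beta> * s) \<cdot>\<^sub>m 1\<^sub>m n) *\<^sub>v x0"
        using mat_exp_carrier[OF M, of s] x0 by (intro minus_mult_distrib_mat_vec[of _ n n]) auto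
      ultimately show ?thesis unfolding h_def M_def[symmetric] using x0
        by (intro eq_vecI) auto
    qed
    then show ?thesis unfolding eps_fun_def \<Gamma>_def M_def by simp
  qed
  show ?thesis
  proof (rule vec_integral_cong[OF vec_integral_mult_mat[OF vec_integral_add[OF ih ie] \<Gamma>]])
    have "x0 + (-1) \<cdot>\<^sub>v x0 = 0\<^sub>v n" using x0 by (intro eq_vecI) auto
    then show "\<Gamma> *\<^sub>v (x0 + (-1) \<cdot>\<^sub>v x0) = 0\<^sub>v (2 * n)" using \<Gamma> by (intro eq_vecI) auto
    fix s
    show "\<Gamma> *\<^sub>v (h s + - exp (- \<beta> * s) \<cdot>\<^sub>v x0) = eps_fun n c \<beta> x0 s" using eps by simp
    let ?d = "h s + (- exp (- \<beta> * s)) \<cdot>\<^sub>v x0"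
    have d: "?d \<in> carrier_vec n" using hc x0 by auto
    have "Mb *\<^sub>v h s = M *\<^sub>v h s + \<beta> \<cdot>\<^sub>v h s"
    proof -
      have "(\<beta> \<cdot>\<^sub>m 1\<^sub>m n) *\<^sub>v h s = \<beta> \<cdot>\<^sub>v h s" using hc[of s] by (intro eq_vecI) auto
      then show ?thesis unfolding Mb_def using M hc[of s] by (simp add: add_mult_distrib_mat_vec[of _ n n])
    qed
    \<comment> \<open>Writing \<open>M\<close> as \<open>Mb\<close> minus \<beta> times the identity
      separates the decay of the error from its forcing, which \<Gamma> maps to the last
      coordinate.\<close>
    then have "M *\<^sub>v h s + (\<beta> * exp (- \<beta> * s)) \<cdot>\<^sub>v x0 = (- \<beta>) \<cdot>\<^sub>v ?d + Mb *\<^sub>v h s"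
      using hc[of s] x0 M by (intro eq_vecI) (auto simp: algebra_simps)
    then have "\<Gamma> *\<^sub>v (M *\<^sub>v h s + (\<beta> * exp (- \<beta> * s)) \<cdot>\<^sub>v x0) = (- \<beta>) \<cdot>\<^sub>v (\<Gamma> *\<^sub>v ?d) + \<Gamma> *\<^sub>v (Mb *\<^sub>v h s)"
      using \<Gamma> Mb hc[of s] d mult_mat_vec[OF \<Gamma> d, of "- \<beta>"]
      by (simp add: mult_add_distrib_mat_vec[OF \<Gamma>])
    moreover have "\<Gamma> *\<^sub>v (Mb *\<^sub>v h s) = h s $ (n - 1) \<cdot>\<^sub>v out_col n"
      using assoc_mult_mat_vec[OF \<Gamma> Mb hc[of s]] \<Gamma>M G_f_mult_vec[OF n hc[of s]] by simp
    ultimately show "\<Gamma> *\<^sub>v (M *\<^sub>v h s + (\<beta> * exp (- \<beta> * s)) \<cdot>\<^sub>v x0) =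
        (- \<beta>) \<cdot>\<^sub>v eps_fun n c \<beta> x0 s + h s $ (n - 1) \<cdot>\<^sub>v out_col n"
      unfolding eps by simp
  qed
qed

text \<open>Both sides have decay rate \<beta>, start at zero and are driven by the right-hand side
  of the equation for \<chi>. So \<delta> is the filtered derivative of \<chi>, although it is
  computed without differentiation.\<close>

lemma filtered_dynamics:
  assumes n: "n \<ge> 1" and x0: "x0 \<in> carrier_vec n"
    and x: "lin_ode_sol (plant_A n a) (\<lambda>s. u s \<cdot>\<^sub>v plant_B n b) x0 T x"
    and zeta: "lin_ode_sol (comp_mat n c) (\<lambda>s. u s \<cdot>\<^sub>v filt_B n) (0\<^sub>v n) T \<zeta>"
    and mu: "lin_ode_sol (comp_mat n c) (\<lambda>s. (x s $ (n - 1)) \<cdot>\<^sub>v filt_B n) (0\<^sub>v n) T \<mu>"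
    and phi: "lin_ode_sol ((- \<beta>) \<cdot>\<^sub>m 1\<^sub>m (2 * n)) (\<lambda>s. \<zeta> s @\<^sub>v \<mu> s) (0\<^sub>v (2 * n)) T \<phi>"
    and upsilon: "\<forall>\<tau>\<in>{0..T}. ((\<lambda>s. - \<beta> * \<upsilon> s + u s) has_integral \<upsilon> \<tau>) {0..\<tau>}"
    and ne: "\<not> eigenvalue (comp_mat n c) (- \<beta>)"
    and t: "t \<in> {0..T}"
  shows "(\<zeta> t @\<^sub>v \<mu> t) - \<beta> \<cdot>\<^sub>v \<phi> t = A_f n a b c *\<^sub>v \<phi> t + \<upsilon> t \<cdot>\<^sub>v in_col n + eps_fun n c \<beta> x0 t"
    and "\<phi> t \<in> carrier_vec (2 * n)" and "eps_fun n c \<beta> x0 t \<in> carrier_vec (2 * n)"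
proof -
  let ?m = "2 * n"
  let ?A = "A_f n a b c" and ?e = "eps_fun n c \<beta> x0" and ?\<chi> = "\<lambda>s. \<zeta> s @\<^sub>v \<mu> s"
  define h where "h s = mat_exp (s \<cdot>\<^sub>m transpose_mat (comp_mat n c)) *\<^sub>v x0" for s
  define N where "N = (- \<beta>) \<cdot>\<^sub>m (1\<^sub>m ?m :: real mat)"
  have N: "N \<in> carrier_mat ?m ?m" by (simp add: N_def)
  have Nv: "N *\<^sub>v v = (- \<beta>) \<cdot>\<^sub>v v" if "v \<in> carrier_vec ?m" for v
    unfolding N_def using that by (intro eq_vecI) auto
  note A = A_f_carrier[of n a b c]
  note ichi = chi_integral[OF n x0 x zeta mu, folded h_def]
  note ieps = eps_integral[OF n x0 ne, of T, folded h_def]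
  have chi: "?\<chi> s \<in> carrier_vec ?m" if "s \<in> {0..T}" for s
    using ichi that by (auto simp: vec_integral_def)
  have iphi: "vec_integral ?m T (\<lambda>s. N *\<^sub>v \<phi> s + ?\<chi> s) (0\<^sub>v ?m) \<phi>"
    by (rule vec_integral_of_lin_ode_sol[OF phi[folded N_def] N chi])
  have phic: "\<phi> s \<in> carrier_vec ?m" if "s \<in> {0..T}" for s
    using iphi that by (auto simp: vec_integral_def)
  have epsc: "?e s \<in> carrier_vec ?m" if "s \<in> {0..T}" for s
    using ieps that by (auto simp: vec_integral_def)
  have iups: "vec_integral ?m T (\<lambda>s. (- \<beta> * \<upsilon> s + u s) \<cdot>\<^sub>v in_col n) (0\<^sub>v ?m) (\<lambda>s. \<upsilon> s \<cdot>\<^sub>v in_col n)"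
    by (rule vec_integral_scalar) (use upsilon in auto)
  define g where "g s = ?A *\<^sub>v ?\<chi> s + u s \<cdot>\<^sub>v in_col n + h s $ (n - 1) \<cdot>\<^sub>v out_col n" for s
  have g: "g s \<in> carrier_vec ?m" if "s \<in> {0..T}" for s
    using chi[OF that] A by (auto simp: g_def)
  have dims: "dim_vec (in_col n) = ?m" "dim_vec (out_col n) = ?m" "dim_row ?A = ?m"
    using in_out_col_carrier[of n] A by (auto simp only: carrier_vecD carrier_matD)
  define r where "r s = ?A *\<^sub>v \<phi> s + \<upsilon> s \<cdot>\<^sub>v in_col n + ?e s" for s
  define \<delta> where "\<delta> s = ?\<chi> s + (- \<beta>) \<cdot>\<^sub>v \<phi> s" for s
  have ir: "vec_integral ?m T (\<lambda>s. N *\<^sub>v r s + g s) (0\<^sub>v ?m) r"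
  proof (rule vec_integral_cong[OF vec_integral_add[OF vec_integral_add[OF vec_integral_mult_mat[OF iphi A] iups] ieps]])
    show "?A *\<^sub>v 0\<^sub>v ?m + 0\<^sub>v ?m + 0\<^sub>v ?m = 0\<^sub>v ?m" using A by (intro eq_vecI) auto
    fix s assume s: "s \<in> {0..T}"
    show "?A *\<^sub>v \<phi> s + \<upsilon> s \<cdot>\<^sub>v in_col n + ?e s = r s" by (simp add: r_def)
    have r: "r s \<in> carrier_vec ?m" using A phic[OF s] epsc[OF s] by (auto simp: r_def)
    have "?A *\<^sub>v (N *\<^sub>v \<phi> s + ?\<chi> s) = (- \<beta>) \<cdot>\<^sub>v (?A *\<^sub>v \<phi> s) + ?A *\<^sub>v ?\<chi> s"
      unfolding Nv[OF phic[OF s]] using A phic[OF s] chi[OF s] mult_mat_vec[OF A phic[OF s], of "- \<beta>"]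
      by (simp add: mult_add_distrib_mat_vec[OF A])
    then show "?A *\<^sub>v (N *\<^sub>v \<phi> s + ?\<chi> s) + (- \<beta> * \<upsilon> s + u s) \<cdot>\<^sub>v in_col n
        + ((- \<beta>) \<cdot>\<^sub>v ?e s + h s $ (n - 1) \<cdot>\<^sub>v out_col n) = N *\<^sub>v r s + g s"
      unfolding Nv[OF r] using carrier_vecD[OF epsc[OF s]]
      by (intro eq_vecI) (auto simp: r_def g_def dims algebra_simps)
  qed
  have id: "vec_integral ?m T (\<lambda>s. N *\<^sub>v \<delta> s + g s) (0\<^sub>v ?m) \<delta>"
  proof (rule vec_integral_cong[OF vec_integral_add[OF ichi vec_integral_smult[OF iphi, of "- \<beta>"]]])
    show "0\<^sub>v ?m + (- \<beta>) \<cdot>\<^sub>v 0\<^sub>v ?m = 0\<^sub>v ?m" by (intro eq_vecI) auto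
    fix s assume s: "s \<in> {0..T}"
    show "?\<chi> s + (- \<beta>) \<cdot>\<^sub>v \<phi> s = \<delta> s" by (simp add: \<delta>_def)
    have d: "\<delta> s \<in> carrier_vec ?m" using phic[OF s] chi[OF s] by (auto simp: \<delta>_def)
    show "?A *\<^sub>v ?\<chi> s + u s \<cdot>\<^sub>v in_col n + h s $ (n - 1) \<cdot>\<^sub>v out_col n + (- \<beta>) \<cdot>\<^sub>v (N *\<^sub>v \<phi> s + ?\<chi> s) = N *\<^sub>v \<delta> s + g s"
      unfolding Nv[OF d] Nv[OF phic[OF s]] g_def[symmetric] using carrier_vecD[OF phic[OF s]] carrier_vecD[OF chi[OF s]] carrier_vecD[OF g[OF s]]
      by (intro eq_vecI) (auto simp: \<delta>_def algebra_simps)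
  qed
  have "\<delta> t = r t" by (rule linear_integral_equation_unique[OF id ir N g t])
  moreover have "?\<chi> t - \<beta> \<cdot>\<^sub>v \<phi> t = \<delta> t"
    using carrier_vecD[OF phic[OF t]] carrier_vecD[OF chi[OF t]] unfolding \<delta>_def by (intro eq_vecI) auto
  ultimately show "?\<chi> t - \<beta> \<cdot>\<^sub>v \<phi> t = ?A *\<^sub>v \<phi> t + \<upsilon> t \<cdot>\<^sub>v in_col n + ?e t" by (simp add: r_def)
  show "\<phi> t \<in> carrier_vec ?m" "?e t \<in> carrier_vec ?m" using phic epsc t by auto
qed

section \<open>From sampled signals to the stabilization criterion\<close>

theorem theorem2:
  fixes n N Nb :: nat
    and a b c :: "nat \<Rightarrow> real" and \<beta> :: real
    and x0 :: "real vec" and u :: "real \<Rightarrow> real" and t :: "nat \<Rightarrow> real"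
    and x \<zeta> \<mu> \<phi> :: "real \<Rightarrow> real vec" and \<upsilon> :: "real \<Rightarrow> real"
    and W Db Pb Ub :: "real mat"
  assumes n_pos: "n \<ge> 1"
    and x0: "x0 \<in> carrier_vec n"
    and times: "0 < t 1" "\<forall>k. 1 \<le> k \<and> k < N \<longrightarrow> t k < t (Suc k)"
    and u_int: "u absolutely_integrable_on {0..t N}"
    and plant: "lin_ode_sol (plant_A n a) (\<lambda>s. u s \<cdot>\<^sub>v plant_B n b) x0 (t N) x"
    and zeta: "lin_ode_sol (comp_mat n c) (\<lambda>s. u s \<cdot>\<^sub>v filt_B n) (0\<^sub>v n) (t N) \<zeta>"
    and mu: "lin_ode_sol (comp_mat n c) (\<lambda>s. (x s $ (n - 1)) \<cdot>\<^sub>v filt_B n) (0\<^sub>v n) (t N) \<mu>"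
    and phi: "lin_ode_sol ((- \<beta>) \<cdot>\<^sub>m 1\<^sub>m (2 * n)) (\<lambda>s. \<zeta> s @\<^sub>v \<mu> s) (0\<^sub>v (2 * n)) (t N) \<phi>"
    and upsilon: "\<forall>\<tau>\<in>{0..t N}. ((\<lambda>s. - \<beta> * \<upsilon> s + u s) has_integral \<upsilon> \<tau>) {0..\<tau>}"
    and A1: "coprime (den_poly n a) (num_poly n b)"
    and A2: "\<not> eigenvalue (comp_mat n c) (- \<beta>)"
    and W: "W \<in> carrier_mat N Nb"
    and A3_E: "sample_mat (2 * n) N t (eps_fun n c \<beta> x0) * W = 0\<^sub>m (2 * n) Nb"
    and Db: "Db = sample_mat (2 * n) N t (\<lambda>s. (\<zeta> s @\<^sub>v \<mu> s) - \<beta> \<cdot>\<^sub>v \<phi> s) * W"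
    and Pb: "Pb = sample_mat (2 * n) N t \<phi> * W"
    and Ub: "Ub = mat 1 N (\<lambda>(i,k). \<upsilon> (t (k + 1))) * W"
    and A3_rank: "vec_space.rank (2 * n + 1) (Pb @\<^sub>r Ub) = 2 * n + 1"
  shows "(\<forall>Z \<in> carrier_mat (2 * n) Nb.
            neg_def (Db * transpose_mat Z + Z * transpose_mat Db) \<and>
            pos_def (Z * transpose_mat Pb + Pb * transpose_mat Z) \<and>
            Z * transpose_mat Pb - Pb * transpose_mat Z = 0\<^sub>m (2 * n) (2 * n)
          \<longrightarrow> invertible_mat (Z * transpose_mat Pb) \<and>
              hurwitz (A_f n a b c + B_f n * (Ub * transpose_mat Z * mat_inv (Z * transpose_mat Pb))))
       \<and> (\<forall>K \<in> carrier_mat 1 (2 * n). hurwitz (A_f n a b c + B_f n * K) \<longrightarrow>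
            (\<exists>Z \<in> carrier_mat (2 * n) Nb.
              neg_def (Db * transpose_mat Z + Z * transpose_mat Db) \<and>
              pos_def (Z * transpose_mat Pb + Pb * transpose_mat Z) \<and>
              Z * transpose_mat Pb - Pb * transpose_mat Z = 0\<^sub>m (2 * n) (2 * n) \<and>
              K = Ub * transpose_mat Z * mat_inv (Z * transpose_mat Pb)))"
proof -
  let ?m = "2 * n"
  let ?A = "A_f n a b c" and ?B = "B_f n"
  define D where "D = sample_mat ?m N t (\<lambda>s. (\<zeta> s @\<^sub>v \<mu> s) - \<beta> \<cdot>\<^sub>v \<phi> s)"
  define P where "P = sample_mat ?m N t \<phi>"
  define E where "E = sample_mat ?m N t (eps_fun n c \<beta> x0)"
  define U where "U = mat 1 N (\<lambda>(i,k). \<upsilon> (t (k + 1)))"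
  note A = A_f_carrier[of n a b c]
  have B: "?B \<in> carrier_mat ?m 1" by (simp add: B_f_def)
  have carr: "D \<in> carrier_mat ?m N" "P \<in> carrier_mat ?m N" "E \<in> carrier_mat ?m N" "U \<in> carrier_mat 1 N"
    by (auto simp: D_def P_def E_def U_def sample_mat_def)
  have mono: "t j \<le> t k" if "1 \<le> j" "j \<le> k" "k \<le> N" for j k
    using that(2,3)
  proof (induction k rule: dec_induct)
    case (step k)
    then have "t k < t (Suc k)" using times(2) that(1) by auto
    then show ?case using step by auto
  qed simp
  \<comment> \<open>Columns are counted from 0 and sampling times from 1; every sample lies in the
    interval on which the integral equations hold.\<close>
  have tk: "t (k + 1) \<in> {0..t N}" if "k < N" for k
    using mono[of 1 "k + 1"] mono[of "k + 1" N] times(1) that by auto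
  have DE: "D = ?A * P + ?B * U + E"
  proof (rule eq_matI)
    fix i k assume "i < dim_row (?A * P + ?B * U + E)" "k < dim_col (?A * P + ?B * U + E)"
    then have ik: "i < ?m" "k < N" using carr by auto
    note dyn = filtered_dynamics[OF n_pos x0 plant zeta mu phi upsilon A2 tk[OF ik(2)]]
    have colP: "col P k = \<phi> (t (k + 1))"
      using ik dyn(2) by (intro eq_vecI) (auto simp: P_def sample_mat_def)
    have "D $$ (i,k) = ((\<zeta> (t (k + 1)) @\<^sub>v \<mu> (t (k + 1))) - \<beta> \<cdot>\<^sub>v \<phi> (t (k + 1))) $ i"
      using ik by (simp add: D_def sample_mat_def)
    also have "\<dots> = (?A *\<^sub>v \<phi> (t (k + 1))) $ i + \<upsilon> (t (k + 1)) * in_col n $ i + eps_fun n c \<beta> x0 (t (k + 1)) $ i"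
      unfolding dyn(1) using ik carrier_vecD[OF dyn(3)] carrier_matD(1)[OF A] by simp
    also have "(?A *\<^sub>v \<phi> (t (k + 1))) $ i = (?A * P) $$ (i,k)"
      using ik A carr colP by simp
    also have "\<upsilon> (t (k + 1)) * in_col n $ i = (?B * U) $$ (i,k)"
      using ik n_pos by (auto simp: B_f_def U_def in_col_def filt_B_def scalar_prod_def)
    also have "eps_fun n c \<beta> x0 (t (k + 1)) $ i = E $$ (i,k)"
      using ik by (simp add: E_def sample_mat_def)
    finally show "D $$ (i,k) = (?A * P + ?B * U + E) $$ (i,k)"
      using ik A B carr by simp
  qed (use A B carr in auto)
  have PbUb: "Pb = P * W" "Ub = U * W" and DbW: "Db = D * W" and EW: "E * W = 0\<^sub>m ?m Nb"
    using Pb Ub Db A3_E by (auto simp: P_def U_def D_def E_def)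
  have Pc: "Pb \<in> carrier_mat ?m Nb" and Uc: "Ub \<in> carrier_mat 1 Nb"
    unfolding PbUb using carr W by auto
  \<comment> \<open>The unknown initial state enters the data through \<open>E\<close> alone, which
    \<open>W\<close> annihilates; the transformed data obey the model exactly.\<close>
  have "Db = (?A * P + ?B * U) * W + E * W"
    unfolding DbW DE by (rule add_mult_distrib_mat[of _ ?m N]) (use A B carr W in auto)
  also have "\<dots> = (?A * P + ?B * U) * W"
    unfolding EW using A B carr W by (intro right_add_zero_mat) auto
  also have "\<dots> = ?A * P * W + ?B * U * W"
    by (rule add_mult_distrib_mat[of _ ?m N]) (use A B carr W in auto)
  also have "\<dots> = ?A * Pb + ?B * Ub"
    unfolding PbUb using assoc_mult_mat[OF A carr(2) W] assoc_mult_mat[OF B carr(4) W] by simp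
  finally have D_eq: "Db = ?A * Pb + ?B * Ub" .
  show ?thesis
    using data_driven_stabilization[OF A B Pc Uc D_eq A3_rank] by blast
qed

end
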